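(* If $\langle M,\in^M\rangle$ is a model of Gödel–Bernays set theory GBC (in its one-sorted formalization, in which every object is a class), then the inclusion structure $\langle M,\subseteq^M\rangle$ on all classes of $M$ is an $\omega$-saturated infinite atomic Boolean algebra.
   Context: In the one-sorted formalization of GBC every object is a class, and sets are the classes that are elements of some class. For $\langle M,\in^M\rangle$, $a\subseteq^M b$ iff for all $c\in M$, $c\in^M a\Rightarrow c\in^M b$. An atomic Boolean algebra is one in which every nonzero element lies above a minimal nonzero element (atom). $\omega$-saturated means every 1-type over finitely many parameters finitely satisfiable in the structure is realized. *)

theory Defs
  imports "HOL-Algebra.Lattice"
begin

section \<open>First-order logic with equality and one binary relation symbol\<close>

text \<open>Variables are de Bruijn indices: \<open>FEx\<close> binds index 0 and shifts the others up by one.\<close>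

datatype fm =
    FRel nat nat
  | FEq nat nat
  | FNot fm
  | FAnd fm fm
  | FEx fm

fun vars_below :: "nat \<Rightarrow> fm \<Rightarrow> bool" where
  "vars_below n (FRel i j) \<longleftrightarrow> i < n \<and> j < n"
| "vars_below n (FEq i j) \<longleftrightarrow> i < n \<and> j < n"
| "vars_below n (FNot \<phi>) \<longleftrightarrow> vars_below n \<phi>"
| "vars_below n (FAnd \<phi> \<psi>) \<longleftrightarrow> vars_below n \<phi> \<and> vars_below n \<psi>"
| "vars_below n (FEx \<phi>) \<longleftrightarrow> vars_below (Suc n) \<phi>"

text \<open>
  Quantifiers range over \<open>D\<close>, while the values in the environment may lie outside \<open>D\<close>.
  Satisfaction in the structure \<open>(D, R)\<close> is the case of an environment with values in \<open>D\<close>.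
  For a structure \<open>(M, R)\<close> with \<open>D \<subseteq> M\<close> and an environment with values in \<open>M\<close>, this is
  satisfaction in \<open>(M, R)\<close> of the formula with all its quantifiers relativized to \<open>D\<close>.
\<close>

fun sat :: "'a set \<Rightarrow> ('a \<Rightarrow> 'a \<Rightarrow> bool) \<Rightarrow> 'a list \<Rightarrow> fm \<Rightarrow> bool" where
  "sat D R env (FRel i j) \<longleftrightarrow> R (env ! i) (env ! j)"
| "sat D R env (FEq i j) \<longleftrightarrow> env ! i = env ! j"
| "sat D R env (FNot \<phi>) \<longleftrightarrow> \<not> sat D R env \<phi>"
| "sat D R env (FAnd \<phi> \<psi>) \<longleftrightarrow> sat D R env \<phi> \<and> sat D R env \<psi>"
| "sat D R env (FEx \<phi>) \<longleftrightarrow> (\<exists>x\<in>D. sat D R (x # env) \<phi>)"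

text \<open>
  A 1-type over the parameters \<open>ps\<close> is a set \<open>p\<close> of formulas in which index 0 is the type
  variable and index \<open>Suc i\<close> denotes \<open>ps ! i\<close>; it need not be complete.
\<close>

definition omega_saturated :: "'a set \<Rightarrow> ('a \<Rightarrow> 'a \<Rightarrow> bool) \<Rightarrow> bool" where
  "omega_saturated D R \<longleftrightarrow>
    (\<forall>ps p. set ps \<subseteq> D \<longrightarrow>
       (\<forall>\<phi>\<in>p. vars_below (Suc (length ps)) \<phi>) \<longrightarrow>
       (\<forall>q. finite q \<longrightarrow> q \<subseteq> p \<longrightarrow> (\<exists>x\<in>D. \<forall>\<phi>\<in>q. sat D R (x # ps) \<phi>)) \<longrightarrow>
       (\<exists>x\<in>D. \<forall>\<phi>\<in>p. sat D R (x # ps) \<phi>))"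


section \<open>Atomic Boolean algebras, as partially ordered sets\<close>

locale boolean_lattice = bounded_lattice L for L (structure) +
  assumes meet_join_distrib:
    "\<lbrakk>x \<in> carrier L; y \<in> carrier L; z \<in> carrier L\<rbrakk> \<Longrightarrow> x \<sqinter> (y \<squnion> z) = (x \<sqinter> y) \<squnion> (x \<sqinter> z)"
    and complement_exists:
    "x \<in> carrier L \<Longrightarrow> \<exists>y\<in>carrier L. x \<sqinter> y = \<bottom> \<and> x \<squnion> y = \<top>"

definition atom_of :: "('a, 'b) gorder_scheme \<Rightarrow> 'a \<Rightarrow> bool" where
  "atom_of L a \<longleftrightarrow> a \<in> carrier L \<and> a \<noteq> \<bottom>\<^bsub>L\<^esub> \<and>
     (\<forall>b\<in>carrier L. b \<noteq> \<bottom>\<^bsub>L\<^esub> \<longrightarrow> b \<sqsubseteq>\<^bsub>L\<^esub> a \<longrightarrow> b = a)"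

locale atomic_boolean_lattice = boolean_lattice L for L (structure) +
  assumes atom_below:
    "\<lbrakk>x \<in> carrier L; x \<noteq> \<bottom>\<rbrakk> \<Longrightarrow> \<exists>a. atom_of L a \<and> a \<sqsubseteq> x"

definition order_structure :: "'a set \<Rightarrow> ('a \<Rightarrow> 'a \<Rightarrow> bool) \<Rightarrow> 'a gorder" where
  "order_structure D R = \<lparr>carrier = D, eq = (=), le = R\<rparr>"


section \<open>Models of GBC\<close>

text \<open>
  In the following, \<open>M\<close> is the collection of all classes of the model and \<open>E\<close> its membership
  relation. All quantifiers are bounded by \<open>M\<close>, since \<open>E\<close> is arbitrary outside of \<open>M\<close>.
\<close>

definition incl :: "'a set \<Rightarrow> ('a \<Rightarrow> 'a \<Rightarrow> bool) \<Rightarrow> 'a \<Rightarrow> 'a \<Rightarrow> bool" where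
  "incl M E a b \<longleftrightarrow> (\<forall>c\<in>M. E c a \<longrightarrow> E c b)"

definition sets_of :: "'a set \<Rightarrow> ('a \<Rightarrow> 'a \<Rightarrow> bool) \<Rightarrow> 'a set" where
  "sets_of M E = {x \<in> M. \<exists>y\<in>M. E x y}"

definition is_upair :: "'a set \<Rightarrow> ('a \<Rightarrow> 'a \<Rightarrow> bool) \<Rightarrow> 'a \<Rightarrow> 'a \<Rightarrow> 'a \<Rightarrow> bool" where
  "is_upair M E p x y \<longleftrightarrow> (\<forall>w\<in>M. E w p \<longleftrightarrow> w = x \<or> w = y)"

text \<open>Kuratowski pairs: \<open>p = {{x}, {x, y}}\<close> in the sense of the model\<close>

definition is_opair :: "'a set \<Rightarrow> ('a \<Rightarrow> 'a \<Rightarrow> bool) \<Rightarrow> 'a \<Rightarrow> 'a \<Rightarrow> 'a \<Rightarrow> bool" where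
  "is_opair M E p x y \<longleftrightarrow>
     (\<exists>u\<in>M. \<exists>v\<in>M. is_upair M E u x x \<and> is_upair M E v x y \<and> is_upair M E p u v)"

definition maps_to :: "'a set \<Rightarrow> ('a \<Rightarrow> 'a \<Rightarrow> bool) \<Rightarrow> 'a \<Rightarrow> 'a \<Rightarrow> 'a \<Rightarrow> bool" where
  "maps_to M E F x y \<longleftrightarrow> (\<exists>p\<in>M. is_opair M E p x y \<and> E p F)"

definition single_valued_class :: "'a set \<Rightarrow> ('a \<Rightarrow> 'a \<Rightarrow> bool) \<Rightarrow> 'a \<Rightarrow> bool" where
  "single_valued_class M E F \<longleftrightarrow>
     (\<forall>x\<in>M. \<forall>y\<in>M. \<forall>z\<in>M. maps_to M E F x y \<longrightarrow> maps_to M E F x z \<longrightarrow> y = z)"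

text \<open>
  Class comprehension is the usual predicative scheme: the formulas may have arbitrary classes
  as parameters, but quantify over sets only.
\<close>

locale gbc_model =
  fixes M :: "'a set" and E :: "'a \<Rightarrow> 'a \<Rightarrow> bool"
  assumes extensionality:
    "\<forall>A\<in>M. \<forall>B\<in>M. (\<forall>x\<in>M. E x A \<longleftrightarrow> E x B) \<longrightarrow> A = B"
    and pairing:
    "\<forall>x\<in>sets_of M E. \<forall>y\<in>sets_of M E. \<exists>p\<in>sets_of M E. is_upair M E p x y"
    and union:
    "\<forall>a\<in>sets_of M E. \<exists>u\<in>sets_of M E. \<forall>w\<in>M. E w u \<longleftrightarrow> (\<exists>y\<in>M. E w y \<and> E y a)"
    and power_set:
    "\<forall>a\<in>sets_of M E. \<exists>p\<in>sets_of M E. \<forall>w\<in>sets_of M E. E w p \<longleftrightarrow> incl M E w a"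
    and infinity:
    "\<exists>a\<in>sets_of M E.
       (\<exists>z\<in>M. E z a \<and> (\<forall>w\<in>M. \<not> E w z)) \<and>
       (\<forall>x\<in>M. E x a \<longrightarrow> (\<exists>s\<in>M. E s a \<and> (\<forall>w\<in>M. E w s \<longleftrightarrow> E w x \<or> w = x)))"
    and class_comprehension:
    "\<forall>\<phi> ps. set ps \<subseteq> M \<longrightarrow> vars_below (Suc (length ps)) \<phi> \<longrightarrow>
       (\<exists>A\<in>M. \<forall>x\<in>sets_of M E. E x A \<longleftrightarrow> sat (sets_of M E) E (x # ps) \<phi>)"
    and replacement:
    "\<forall>F\<in>M. single_valued_class M E F \<longrightarrow>
       (\<forall>a\<in>sets_of M E. \<exists>b\<in>sets_of M E. \<forall>y\<in>M. E y b \<longleftrightarrow> (\<exists>x\<in>M. E x a \<and> maps_to M E F x y))"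
    and foundation:
    "\<forall>A\<in>M. (\<exists>x\<in>M. E x A) \<longrightarrow> (\<exists>x\<in>M. E x A \<and> \<not> (\<exists>y\<in>M. E y x \<and> E y A))"
    and global_choice:
    "\<exists>F\<in>M. single_valued_class M E F \<and>
       (\<forall>x\<in>sets_of M E. (\<exists>y\<in>M. E y x) \<longrightarrow> (\<exists>y\<in>M. E y x \<and> maps_to M E F x y))"

end

theory Submission
  imports Defs "HOL-Library.Countable"
begin

text \<open>
  Identify a class with the set of its elements. The classes then form a field of subsets of the
  collection of all sets, containing all singletons, in which every externally infinite member
  splits into two infinite members. For such a field, let the parameters of a 1-type cut the
  universe into finitely many cells. An Ehrenfeucht--Fraisse argument shows that the formulas of
  quantifier rank at most \<open>r\<close> satisfied by \<open>x\<close> are determined by the numbers of elements of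
  \<open>x\<close> and of its complement in each cell, truncated at a bound depending on \<open>r\<close>. Realizing
  larger and larger finite parts of the type and passing to a subsequence along which each of
  these numbers is constant or tends to infinity, one reads off the cell sizes of a realization;
  it exists by the splitting property.

  To split an infinite class \<open>c\<close> into two infinite classes, iterate inside the model the step
  \<open>m \<mapsto> m \<union> {f m, g m}\<close>, where \<open>f m\<close> and \<open>g m\<close> are distinct chosen elements of
  \<open>c - m\<close>. The sets reached are linearly ordered by inclusion, so that the class of all
  \<open>f m\<close> contains no \<open>g m\<close>, and externally both kinds of elements are infinite in number.
\<close>

text \<open>Countability of the language lets the saturation proof exhaust a type over finitely many
  parameters by an increasing sequence of finite parts.\<close>

instance fm :: countable
  by countable_datatype

section \<open>Saturation of fields of sets\<close>

definition big :: "nat \<Rightarrow> 'a set \<Rightarrow> bool" where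
  "big N A \<longleftrightarrow> (finite A \<longrightarrow> N \<le> card A)"

text \<open>Equality of sizes truncated at \<open>N\<close>, with infinite sets counted as large.
  The guards by finiteness are there because \<open>card\<close> is 0 on infinite sets.\<close>

definition near :: "nat \<Rightarrow> 'a set \<Rightarrow> 'b set \<Rightarrow> bool" where
  "near N A B \<longleftrightarrow> (finite A \<and> finite B \<and> card A = card B) \<or> (big N A \<and> big N B)"

lemma near_refl: "near N A A"
  by (auto simp: near_def big_def)

lemma near_sym: "near N A B \<Longrightarrow> near N B A"
  by (auto simp: near_def)

lemma near_mono: "near N A B \<Longrightarrow> k \<le> N \<Longrightarrow> near k A B"
  by (auto simp: near_def big_def)

lemma near_empty_iff: "near N A B \<Longrightarrow> 0 < N \<Longrightarrow> A = {} \<longleftrightarrow> B = {}"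
  by (auto simp: near_def big_def)

lemma big_diff:
  assumes "big (m + n) B" "finite Y" "card Y \<le> m"
  shows "big n (B - Y)"
proof -
  have "card (B \<inter> Y) \<le> m"
    using assms by (meson card_mono inf.cobounded2 le_trans)
  then show ?thesis
    using assms by (auto simp: big_def card_Diff_subset_Int)
qed

text \<open>The small part \<open>X\<close> is matched by an exact copy \<open>Y\<close>. Unless
  \<open>A\<close> and \<open>B\<close> are finite of equal size, both have at least
  \<open>2 * N\<close> elements and keep at least \<open>N\<close> after losing fewer than
  \<open>N\<close>.\<close>

lemma near_remove_small:
  assumes near: "near (2 * N) A B" and X: "X \<subseteq> A" "finite X" "card X < N"
  obtains Y where "Y \<subseteq> B" "finite Y" "card Y = card X" "near N (A - X) (B - Y)"
proof -
  have "finite B \<Longrightarrow> card X \<le> card B"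
    using near X card_mono[OF _ X(1)] by (auto simp: near_def big_def)
  then obtain Y where Y: "Y \<subseteq> B" "finite Y" "card Y = card X"
    by (metis infinite_arbitrarily_large obtain_subset_with_card_n rev_finite_subset)
  have "near N (A - X) (B - Y)"
  proof (cases "finite A \<and> finite B \<and> card A = card B")
    case True
    then show ?thesis
      using X Y by (auto simp: near_def card_Diff_subset)
  next
    case False
    then have "big (N + N) A" "big (N + N) B"
      using near by (auto simp: near_def mult_2)
    then show ?thesis
      using X Y by (auto simp: near_def intro!: big_diff)
  qed
  with Y that show ?thesis by blast
qed

fun qrank :: "fm \<Rightarrow> nat" where
  "qrank (FRel i j) = 0"
| "qrank (FEq i j) = 0"
| "qrank (FNot \<phi>) = qrank \<phi>"
| "qrank (FAnd \<phi> \<psi>) = max (qrank \<phi>) (qrank \<psi>)"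
| "qrank (FEx \<phi>) = Suc (qrank \<phi>)"

lemma sat_isomorphic:
  assumes "inj_on f D" "\<And>x y. x \<in> D \<Longrightarrow> y \<in> D \<Longrightarrow> R x y \<longleftrightarrow> S (f x) (f y)"
  shows "set env \<subseteq> D \<Longrightarrow> vars_below (length env) \<phi> \<Longrightarrow>
    sat D R env \<phi> \<longleftrightarrow> sat (f ` D) S (map f env) \<phi>"
proof (induction \<phi> arbitrary: env)
  case (FRel i j)
  then show ?case using assms(2) by (auto simp: subset_iff)
next
  case (FEq i j)
  then show ?case using assms(1) by (auto simp: subset_iff inj_on_eq_iff)
next
  case (FEx \<phi>)
  have "sat D R (x # env) \<phi> \<longleftrightarrow> sat (f ` D) S (f x # map f env) \<phi>" if "x \<in> D" for x
    using FEx.IH[of "x # env"] FEx.prems that by simp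
  then show ?case by auto
qed auto

lemma omega_saturated_isomorphic:
  assumes inj: "inj_on f D" and R: "\<And>x y. x \<in> D \<Longrightarrow> y \<in> D \<Longrightarrow> R x y \<longleftrightarrow> S (f x) (f y)"
    and sat: "omega_saturated (f ` D) S"
  shows "omega_saturated D R"
  unfolding omega_saturated_def
proof (intro allI impI)
  fix ps p
  assume ps: "set ps \<subseteq> D" and p: "\<forall>\<phi>\<in>p. vars_below (Suc (length ps)) \<phi>"
    and fin: "\<forall>q. finite q \<longrightarrow> q \<subseteq> p \<longrightarrow> (\<exists>x\<in>D. \<forall>\<phi>\<in>q. sat D R (x # ps) \<phi>)"
  have iff: "sat D R (x # ps) \<phi> \<longleftrightarrow> sat (f ` D) S (f x # map f ps) \<phi>" if "x \<in> D" "\<phi> \<in> p" for x \<phi>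
    using sat_isomorphic[of f D R S "x # ps" \<phi>, OF inj R] that ps p by simp
  have "\<exists>y\<in>f ` D. \<forall>\<phi>\<in>q. sat (f ` D) S (y # map f ps) \<phi>" if q: "finite q" "q \<subseteq> p" for q
  proof -
    obtain x where "x \<in> D" "\<forall>\<phi>\<in>q. sat D R (x # ps) \<phi>"
      using fin q by blast
    then show ?thesis
      using iff q(2) by (intro bexI[of _ "f x"]) auto
  qed
  then have "\<forall>q. finite q \<longrightarrow> q \<subseteq> p \<longrightarrow> (\<exists>y\<in>f ` D. \<forall>\<phi>\<in>q. sat (f ` D) S (y # map f ps) \<phi>)"
    by simp
  moreover have "set (map f ps) \<subseteq> f ` D" "\<forall>\<phi>\<in>p. vars_below (Suc (length (map f ps))) \<phi>"
    using ps p by auto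
  ultimately have "\<exists>y\<in>f ` D. \<forall>\<phi>\<in>p. sat (f ` D) S (y # map f ps) \<phi>"
    by (rule sat[unfolded omega_saturated_def, THEN spec, THEN spec, THEN mp, THEN mp, THEN mp, rotated 2])
  then obtain x where "x \<in> D" "\<forall>\<phi>\<in>p. sat (f ` D) S (f x # map f ps) \<phi>" by blast
  then show "\<exists>x\<in>D. \<forall>\<phi>\<in>p. sat D R (x # ps) \<phi>"
    using iff by (intro bexI[of _ x]) simp_all
qed

text \<open>If some finite size occurs infinitely often, the indices with that size are kept.
  Otherwise each size occurs only finitely often, and the indices where \<open>big m\<close> fails
  form a finite union over the sizes below \<open>m\<close>.\<close>

lemma constant_or_divergent_subset:
  assumes "infinite K"
  obtains L where "L \<subseteq> K" "infinite L"
    "(\<exists>m. \<forall>k\<in>L. finite (Z k) \<and> card (Z k) = m) \<or> (\<forall>m. finite {k\<in>L. \<not> big m (Z k)})"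
proof (cases "\<exists>m. infinite {k\<in>K. finite (Z k) \<and> card (Z k) = m}")
  case True
  then obtain m where "infinite {k\<in>K. finite (Z k) \<and> card (Z k) = m}" by blast
  then show ?thesis by (intro that[of "{k\<in>K. finite (Z k) \<and> card (Z k) = m}"]) auto
next
  case False
  have "{k\<in>K. \<not> big m (Z k)} = (\<Union>i<m. {k\<in>K. finite (Z k) \<and> card (Z k) = i})" for m
    by (auto simp: big_def)
  with False assms show ?thesis by (intro that[of K]) auto
qed

text \<open>Thinning once for each member of \<open>S\<close> suffices, since both alternatives
  survive the passage to an infinite subset.\<close>

lemma constant_or_divergent_subset_finite:
  assumes "finite S" "infinite (K :: nat set)"
  obtains L where "L \<subseteq> K" "infinite L"
    "\<And>s. s \<in> S \<Longrightarrow> (\<exists>m. \<forall>k\<in>L. finite (Z s k) \<and> card (Z s k) = m) \<or>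
      (\<forall>m. finite {k\<in>L. \<not> big m (Z s k)})"
  using assms
proof (induction S arbitrary: thesis)
  case empty
  then show ?case by blast
next
  case (insert s S)
  obtain L where L: "L \<subseteq> K" "infinite L" and
    L_S: "\<And>s. s \<in> S \<Longrightarrow> (\<exists>m. \<forall>k\<in>L. finite (Z s k) \<and> card (Z s k) = m) \<or>
      (\<forall>m. finite {k\<in>L. \<not> big m (Z s k)})"
    using insert.IH insert.prems(2) by blast
  obtain L' where L': "L' \<subseteq> L" "infinite L'"
    "(\<exists>m. \<forall>k\<in>L'. finite (Z s k) \<and> card (Z s k) = m) \<or> (\<forall>m. finite {k\<in>L'. \<not> big m (Z s k)})"
    using constant_or_divergent_subset[OF L(2), where Z = "Z s"] by blast
  show ?case
  proof (rule insert.prems(1))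
    show "L' \<subseteq> K" "infinite L'" using L L' by auto
    fix t
    assume "t \<in> insert s S"
    moreover have "finite {k\<in>L'. \<not> big m (Z t k)}" if "finite {k\<in>L. \<not> big m (Z t k)}" for m
      by (rule finite_subset[OF _ that]) (use L'(1) in auto)
    ultimately show "(\<exists>m. \<forall>k\<in>L'. finite (Z t k) \<and> card (Z t k) = m) \<or>
      (\<forall>m. finite {k\<in>L'. \<not> big m (Z t k)})"
      using L'(3) L_S[of t] subsetD[OF L'(1)] by (cases "t = s") (simp, metis insertE)
  qed
qed

text \<open>The axiom \<open>split\<close> excludes the field of finite and cofinite subsets of an
  infinite set, which omits the type of an element that is infinite with infinite
  complement.\<close>

locale splitting_field =
  fixes V :: "'a set" and \<C> :: "'a set set"
  assumes subset_V: "X \<in> \<C> \<Longrightarrow> X \<subseteq> V"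
    and V_mem: "V \<in> \<C>"
    and Diff_mem: "X \<in> \<C> \<Longrightarrow> Y \<in> \<C> \<Longrightarrow> X - Y \<in> \<C>"
    and singleton_mem: "x \<in> V \<Longrightarrow> {x} \<in> \<C>"
    and split: "X \<in> \<C> \<Longrightarrow> infinite X \<Longrightarrow> \<exists>Y\<in>\<C>. Y \<subseteq> X \<and> infinite Y \<and> infinite (X - Y)"
begin

lemma empty_mem: "{} \<in> \<C>"
  using Diff_mem[OF V_mem V_mem] by simp

lemma Int_mem: "X \<in> \<C> \<Longrightarrow> Y \<in> \<C> \<Longrightarrow> X \<inter> Y \<in> \<C>"
  by (metis Diff_mem Diff_Diff_Int)

lemma Un_mem:
  assumes "X \<in> \<C>" "Y \<in> \<C>"
  shows "X \<union> Y \<in> \<C>"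
proof -
  have "X \<union> Y = V - ((V - X) - Y)"
    using assms[THEN subset_V] by auto
  then show ?thesis
    using assms V_mem Diff_mem by metis
qed

lemma UN_mem: "finite I \<Longrightarrow> (\<And>i. i \<in> I \<Longrightarrow> X i \<in> \<C>) \<Longrightarrow> (\<Union>i\<in>I. X i) \<in> \<C>"
  by (induction I rule: finite_induct) (auto intro: empty_mem Un_mem)

lemma finite_mem: "finite X \<Longrightarrow> X \<subseteq> V \<Longrightarrow> X \<in> \<C>"
  using UN_mem[of X "\<lambda>x. {x}"] singleton_mem by auto

text \<open>The response to a move \<open>X\<close> inside one cell. The factor 2 pays for the cut:
  a part with fewer than \<open>N\<close> elements is copied exactly, and if both parts have at
  least \<open>N\<close>, then \<open>B\<close> has at least \<open>2 * N\<close>, so any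
  \<open>N\<close> elements of it will do.\<close>

lemma near_split:
  assumes C: "A \<in> \<C>" "B \<in> \<C>" and near: "near (2 * N) A B" and X: "X \<subseteq> A"
  obtains Y where "Y \<in> \<C>" "Y \<subseteq> B" "near N X Y" "near N (A - X) (B - Y)"
proof (cases "big N X")
  case False
  then obtain Y where "Y \<subseteq> B" "finite Y" "card Y = card X" "near N (A - X) (B - Y)"
    using near_remove_small[OF near X] by (auto simp: big_def)
  then show ?thesis
    using False C that[of Y] subset_V[of B] by (auto simp: near_def big_def intro: finite_mem)
next
  case X_big: True
  show ?thesis
  proof (cases "big N (A - X)")
    \<comment> \<open>Here the complement of \<open>X\<close> is the small part, so it is the one
      copied, and the response is \<open>B - Y\<close>.\<close>
    case False
    then obtain Y where Y: "Y \<subseteq> B" "finite Y" "card Y = card (A - X)"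
        "near N (A - (A - X)) (B - Y)"
      using near_remove_small[OF near, of "A - X"] by (auto simp: big_def)
    moreover have "A - (A - X) = X" "B - (B - Y) = Y" "Y \<in> \<C>"
      using X Y C subset_V[of B] by (auto intro: finite_mem)
    ultimately show ?thesis
      using False C Diff_mem that[of "B - Y"] by (auto simp: near_def big_def)
  next
    case True
    have "finite A \<Longrightarrow> 2 * N \<le> card A"
      using True X_big X card_Un_disjoint[of X "A - X"] finite_subset[of X A]
      by (auto simp: big_def Un_absorb1)
    then have B: "big (N + N) B"
      using near by (auto simp: near_def big_def)
    then obtain Y where Y: "Y \<subseteq> B" "finite Y" "card Y = N"
      by (metis add_leD1 big_def infinite_arbitrarily_large obtain_subset_with_card_n)
    show ?thesis
    proof
      show "Y \<in> \<C>" using Y C subset_V[of B] by (auto intro: finite_mem)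
      show "near N X Y" using X_big Y by (auto simp: near_def big_def)
      show "near N (A - X) (B - Y)"
        using True big_diff[OF B] Y by (auto simp: near_def)
    qed (fact Y)
  qed
qed

section \<open>Cells cut out by finitely many sets\<close>

definition cell :: "'a set list \<Rightarrow> bool list \<Rightarrow> 'a set" where
  "cell env bs = {v \<in> V. map (\<lambda>X. v \<in> X) env = bs}"

lemma cell_Cons: "cell (X # env) (b # bs) = (if b then cell env bs \<inter> X else cell env bs - X)"
  by (auto simp: cell_def)

text \<open>Sign lists of the wrong length are harmless, so later statements can range over all
  \<open>bs\<close>.\<close>

lemma cell_eq_empty: "length bs \<noteq> length env \<Longrightarrow> cell env bs = {}"
  by (auto simp: cell_def)

lemma cell_mem: "set env \<subseteq> \<C> \<Longrightarrow> cell env bs \<in> \<C>"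
proof (induction env arbitrary: bs)
  case Nil
  then show ?case using V_mem empty_mem by (cases bs) (auto simp: cell_def)
next
  case (Cons X env)
  then show ?case
    using empty_mem by (cases bs) (auto simp: cell_Cons cell_eq_empty intro: Int_mem Diff_mem)
qed

text \<open>Distinct cells are disjoint, so a part of each can be prescribed independently. The
  union of the parts is a member because only the finitely many sign lists of length
  \<open>length env\<close> contribute.\<close>

lemma glue_cells:
  assumes "set env \<subseteq> \<C>" "\<And>bs. Y bs \<in> \<C>" "\<And>bs. Y bs \<subseteq> cell env bs"
  obtains X where "X \<in> \<C>"
    "\<And>b bs. cell (X # env) (b # bs) = (if b then Y bs else cell env bs - Y bs)"
proof
  let ?X = "\<Union>bs\<in>{bs. length bs = length env}. Y bs"
  have fin: "finite {bs :: bool list. length bs = length env}"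
    using finite_lists_length_eq[of "UNIV :: bool set" "length env"] by simp
  show "?X \<in> \<C>"
    using UN_mem[OF fin] assms(2) by blast
  have "cell env bs \<inter> ?X = Y bs" for bs
  proof (cases "length bs = length env")
    case True
    have "cell env bs \<inter> Y cs \<subseteq> Y bs" for cs
      using assms(3)[of cs] by (cases "bs = cs") (auto simp: cell_def)
    with True assms(3)[of bs] show ?thesis by auto
  next
    case False
    with assms(3)[of bs] show ?thesis by (simp add: cell_eq_empty)
  qed
  then show "cell (?X # env) (b # bs) = (if b then Y bs else cell env bs - Y bs)" for b bs
    unfolding cell_Cons by auto
qed

text \<open>Atomic formulas thus depend only on which cells are empty, which threshold 1 in
  \<open>sat_near\<close> still detects.\<close>

lemma subset_iff_cells:
  assumes "set env \<subseteq> \<C>" "i < length env" "j < length env"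
  shows "env ! i \<subseteq> env ! j \<longleftrightarrow> (\<forall>bs. bs ! i \<and> \<not> bs ! j \<longrightarrow> cell env bs = {})"
proof
  assume "env ! i \<subseteq> env ! j"
  then show "\<forall>bs. bs ! i \<and> \<not> bs ! j \<longrightarrow> cell env bs = {}"
    using assms by (auto simp: cell_def)
next
  assume *: "\<forall>bs. bs ! i \<and> \<not> bs ! j \<longrightarrow> cell env bs = {}"
  show "env ! i \<subseteq> env ! j"
  proof
    fix v
    assume v: "v \<in> env ! i"
    then have "v \<in> cell env (map (\<lambda>X. v \<in> X) env)"
      using assms subset_V[of "env ! i"] nth_mem[of i env] by (auto simp: cell_def subset_iff)
    then show "v \<in> env ! j"
      using * assms v by force
  qed
qed

text \<open>The Ehrenfeucht-Fraisse argument: a quantifier is answered cell by cell, which halves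
  the threshold by \<open>near_split\<close>; at rank 0 the threshold is 1 and still tells empty
  cells from nonempty ones.\<close>

lemma sat_near:
  assumes "length env = length env'" "set env \<subseteq> \<C>" "set env' \<subseteq> \<C>"
    "vars_below (length env) \<phi>" "\<And>bs. near (2 ^ qrank \<phi>) (cell env bs) (cell env' bs)"
  shows "sat \<C> (\<subseteq>) env \<phi> \<longleftrightarrow> sat \<C> (\<subseteq>) env' \<phi>"
  using assms
proof (induction \<phi> arbitrary: env env')
  case (FRel i j)
  have "cell env bs = {} \<longleftrightarrow> cell env' bs = {}" for bs
    using near_empty_iff[OF FRel.prems(5)[of bs]] by simp
  then show ?case
    using FRel.prems by (simp add: subset_iff_cells)
next
  case (FEq i j)
  have "cell env bs = {} \<longleftrightarrow> cell env' bs = {}" for bs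
    using near_empty_iff[OF FEq.prems(5)[of bs]] by simp
  then show ?case
    using FEq.prems unfolding sat.simps set_eq_subset[of "_ ! _"] by (simp add: subset_iff_cells)
next
  case (FNot \<phi>)
  then show ?case by simp
next
  case (FAnd \<phi> \<psi>)
  have "near (2 ^ qrank \<phi>) (cell env bs) (cell env' bs)"
    "near (2 ^ qrank \<psi>) (cell env bs) (cell env' bs)" for bs
    using near_mono[OF FAnd.prems(5)[of bs]] by simp_all
  then show ?case
    using FAnd by simp
next
  case (FEx \<phi>)
  \<comment> \<open>One half of the back-and-forth, stated for arbitrary \<open>env\<close> and
    \<open>env'\<close> so that it also serves with the two exchanged.\<close>
  have ex: "\<exists>Y\<in>\<C>. sat \<C> (\<subseteq>) (Y # env') \<phi>"
    if X: "X \<in> \<C>" "sat \<C> (\<subseteq>) (X # env) \<phi>"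
      and env: "set env \<subseteq> \<C>" "set env' \<subseteq> \<C>" "length env = length env'"
        "vars_below (Suc (length env)) \<phi>"
      and near: "\<And>bs. near (2 * 2 ^ qrank \<phi>) (cell env bs) (cell env' bs)"
    for X env env'
  proof -
    have "\<exists>Y\<in>\<C>. Y \<subseteq> cell env' bs \<and> near (2 ^ qrank \<phi>) (cell env bs \<inter> X) Y \<and>
        near (2 ^ qrank \<phi>) (cell env bs - X) (cell env' bs - Y)" for bs
    proof -
      have "cell env bs - cell env bs \<inter> X = cell env bs - X" by blast
      then show ?thesis
        using near_split[OF cell_mem[OF env(1)] cell_mem[OF env(2)] near, of "cell env bs \<inter> X" bs]
        by (metis Int_lower1)
    qed
    then obtain Y where Y: "\<And>bs. Y bs \<in> \<C>" "\<And>bs. Y bs \<subseteq> cell env' bs"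
      "\<And>bs. near (2 ^ qrank \<phi>) (cell env bs \<inter> X) (Y bs)"
      "\<And>bs. near (2 ^ qrank \<phi>) (cell env bs - X) (cell env' bs - Y bs)"
      by metis
    obtain Z where Z: "Z \<in> \<C>"
      "\<And>b bs. cell (Z # env') (b # bs) = (if b then Y bs else cell env' bs - Y bs)"
      by (rule glue_cells[OF env(2) Y(1,2)]) (rule that)
    have "near (2 ^ qrank \<phi>) (cell (X # env) bs) (cell (Z # env') bs)" for bs
      using Y(3,4) Z(2) by (cases bs) (simp_all add: cell_eq_empty near_refl cell_Cons)
    then have "sat \<C> (\<subseteq>) (Z # env') \<phi>"
      using FEx.IH[of "X # env" "Z # env'"] X Z(1) env by simp
    with Z(1) show ?thesis by blast
  qed
  have "near (2 * 2 ^ qrank \<phi>) (cell env bs) (cell env' bs)" for bs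
    using FEx.prems(5)[of bs] by simp
  then have "(\<exists>X\<in>\<C>. sat \<C> (\<subseteq>) (X # env) \<phi>) \<longleftrightarrow> (\<exists>X\<in>\<C>. sat \<C> (\<subseteq>) (X # env') \<phi>)"
    using ex[of _ env env'] ex[of _ env' env] FEx.prems(1-4) near_sym
    by (metis vars_below.simps(5))
  then show ?case by simp
qed

text \<open>Inside one cell \<open>A\<close>, the set \<open>Y\<close> has to match almost all of
  the \<open>X k\<close>. If one of the two parts has constant finite size, the trace of a single
  \<open>X k0\<close> serves; if both parts grow beyond all bounds, \<open>Y\<close> comes from
  \<open>split\<close>.\<close>

lemma limit_of_subsets:
  assumes A: "A \<in> \<C>" and X: "\<And>k :: nat. X k \<in> \<C>" and K: "infinite K"
    and dich: "\<And>b. (\<exists>m. \<forall>k\<in>K. finite (if b then A \<inter> X k else A - X k) \<and>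
          card (if b then A \<inter> X k else A - X k) = m) \<or>
        (\<forall>m. finite {k\<in>K. \<not> big m (if b then A \<inter> X k else A - X k)})"
  obtains Y where "Y \<in> \<C>" "Y \<subseteq> A" "\<And>N. finite {k\<in>K. \<not> near N (A \<inter> X k) Y}"
    "\<And>N. finite {k\<in>K. \<not> near N (A - X k) (A - Y)}"
proof -
  obtain k0 where k0: "k0 \<in> K" using K by fastforce
  \<comment> \<open>In a finite \<open>A\<close>, the condition \<open>big (Suc (card A))\<close>
    would fail at every index of the infinite set \<open>K\<close>.\<close>
  have div_infinite: "infinite A" if "\<And>m. finite {k\<in>K. \<not> big m (Z k)}" "\<And>k. Z k \<subseteq> A" for Z
  proof
    assume "finite A"
    then have "\<not> big (Suc (card A)) (Z k)" for k
      using that(2)[of k] by (auto simp: big_def card_mono finite_subset less_Suc_eq_le not_le)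
    with that(1)[of "Suc (card A)"] K show False by simp
  qed
  have near_div: "finite {k\<in>K. \<not> near N (Z k) W}"
    if "\<And>m. finite {k\<in>K. \<not> big m (Z k)}" "infinite W" for Z :: "nat \<Rightarrow> 'a set" and W :: "'a set" and N
    by (rule finite_subset[OF _ that(1)[of N]]) (use that(2) in \<open>auto simp: near_def big_def\<close>)
  have near_const: "finite {k\<in>K. \<not> near N (Z k) (Z k0)}"
    if "\<And>k. k \<in> K \<Longrightarrow> finite (Z k) \<and> card (Z k) = m" for Z :: "nat \<Rightarrow> 'a set" and m N
  proof -
    have "{k\<in>K. \<not> near N (Z k) (Z k0)} = {}"
      using that k0 by (auto simp: near_def)
    then show ?thesis by (metis finite.emptyI)
  qed
  have in_C: "A \<inter> X k0 \<in> \<C>" using A X Int_mem by blast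
  have diff: "A - A \<inter> X k0 = A - X k0" by blast
  consider m m' where "\<And>k. k \<in> K \<Longrightarrow> finite (A \<inter> X k) \<and> card (A \<inter> X k) = m"
      "\<And>k. k \<in> K \<Longrightarrow> finite (A - X k) \<and> card (A - X k) = m'"
    | m where "\<And>k. k \<in> K \<Longrightarrow> finite (A \<inter> X k) \<and> card (A \<inter> X k) = m"
      "\<And>m. finite {k\<in>K. \<not> big m (A - X k)}"
    | m where "\<And>k. k \<in> K \<Longrightarrow> finite (A - X k) \<and> card (A - X k) = m"
      "\<And>m. finite {k\<in>K. \<not> big m (A \<inter> X k)}"
    | "\<And>m. finite {k\<in>K. \<not> big m (A \<inter> X k)}" "\<And>m. finite {k\<in>K. \<not> big m (A - X k)}"
    using dich[of True] dich[of False] by (simp only: if_True if_False) meson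
  then show ?thesis
  proof cases
    case 1
    have "finite {k\<in>K. \<not> near N (A \<inter> X k) (A \<inter> X k0)}"
      "finite {k\<in>K. \<not> near N (A - X k) (A - X k0)}" for N
      using near_const[of "\<lambda>k. A \<inter> X k" m N] near_const[of "\<lambda>k. A - X k" m' N] 1 by simp_all
    then show ?thesis
      by (intro that[OF in_C]) (simp_all only: diff Int_lower1)
  next
    case 2
    have "infinite (A - X k0)"
      using div_infinite[OF 2(2)] 2(1)[OF k0] by (auto dest: Diff_infinite_finite simp flip: diff)
    then have "finite {k\<in>K. \<not> near N (A \<inter> X k) (A \<inter> X k0)}"
      "finite {k\<in>K. \<not> near N (A - X k) (A - X k0)}" for N
      using near_const[of "\<lambda>k. A \<inter> X k" m N] near_div[of "\<lambda>k. A - X k" "A - X k0" N] 2 by simp_all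
    then show ?thesis
      by (intro that[OF in_C]) (simp_all only: diff Int_lower1)
  next
    case 3
    have "A = (A \<inter> X k0) \<union> (A - X k0)" by blast
    then have "infinite (A \<inter> X k0)"
      using div_infinite[OF 3(2)] 3(1)[OF k0] by (metis finite_UnI inf_le1)
    then have "finite {k\<in>K. \<not> near N (A \<inter> X k) (A \<inter> X k0)}"
      "finite {k\<in>K. \<not> near N (A - X k) (A - X k0)}" for N
      using near_const[of "\<lambda>k. A - X k" m N] near_div[of "\<lambda>k. A \<inter> X k" "A \<inter> X k0" N] 3 by simp_all
    then show ?thesis
      by (intro that[OF in_C]) (simp_all only: diff Int_lower1)
  next
    case 4
    have "infinite A"
      using div_infinite[OF 4(1)] by blast
    then obtain Y where Y: "Y \<in> \<C>" "Y \<subseteq> A" "infinite Y" "infinite (A - Y)"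
      using split[OF A] by blast
    then show ?thesis
      by (intro that[OF Y(1,2)]) (simp_all add: near_div[OF 4(1)] near_div[OF 4(2)])
  qed
qed

theorem omega_saturated: "omega_saturated \<C> (\<subseteq>)"
  unfolding omega_saturated_def
proof (intro allI impI)
  fix ps p
  assume ps: "set ps \<subseteq> \<C>" and p: "\<forall>\<phi>\<in>p. vars_below (Suc (length ps)) \<phi>"
    and fin_sat: "\<forall>q. finite q \<longrightarrow> q \<subseteq> p \<longrightarrow> (\<exists>X\<in>\<C>. \<forall>\<phi>\<in>q. sat \<C> (\<subseteq>) (X # ps) \<phi>)"
  \<comment> \<open>\<open>X k\<close> will realize the finitely many formulas of \<open>p\<close>
    with code at most \<open>k\<close>.\<close>
  have "\<exists>X\<in>\<C>. \<forall>\<phi>\<in>p. to_nat \<phi> \<le> k \<longrightarrow> sat \<C> (\<subseteq>) (X # ps) \<phi>" for k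
  proof -
    have "finite {\<phi>\<in>p. to_nat \<phi> \<le> k}"
      by (rule finite_subset[of _ "from_nat ` {..k}"]) (auto intro!: image_eqI[where x = "to_nat _"])
    then show ?thesis
      using fin_sat[rule_format, of "{\<phi>\<in>p. to_nat \<phi> \<le> k}"] by blast
  qed
  then obtain X where X: "\<And>k. X k \<in> \<C>"
    and sat_X: "\<And>k \<phi>. \<phi> \<in> p \<Longrightarrow> to_nat \<phi> \<le> k \<Longrightarrow> sat \<C> (\<subseteq>) (X k # ps) \<phi>"
    by metis
  \<comment> \<open>Sign lists for \<open>X k # ps\<close>: one entry for the type variable and one
    for each parameter.\<close>
  define S where "S = {cs :: bool list. length cs = Suc (length ps)}"
  have fin_S: "finite S"
    using finite_lists_length_eq[of "UNIV :: bool set" "Suc (length ps)"] by (simp add: S_def)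
  obtain K where K: "infinite K"
    and K_S: "\<And>cs. cs \<in> S \<Longrightarrow>
      (\<exists>m. \<forall>k\<in>K. finite (cell (X k # ps) cs) \<and> card (cell (X k # ps) cs) = m) \<or>
      (\<forall>m. finite {k\<in>K. \<not> big m (cell (X k # ps) cs)})"
    by (rule constant_or_divergent_subset_finite[OF fin_S, of UNIV "\<lambda>cs k. cell (X k # ps) cs"]) auto
  \<comment> \<open>\<open>?lim bs Y\<close> says that \<open>Y\<close> and its complement in the
    cell have the limiting sizes of \<open>X k\<close> and of its complement there.\<close>
  have "\<exists>Y\<in>\<C>. Y \<subseteq> cell ps bs \<and> (\<forall>N. finite {k\<in>K. \<not> near N (cell ps bs \<inter> X k) Y}) \<and>
      (\<forall>N. finite {k\<in>K. \<not> near N (cell ps bs - X k) (cell ps bs - Y)})" (is "\<exists>Y\<in>\<C>. ?lim bs Y") for bs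
  proof (cases "length bs = length ps")
    case True
    have "(\<exists>m. \<forall>k\<in>K. finite (if b then cell ps bs \<inter> X k else cell ps bs - X k) \<and>
          card (if b then cell ps bs \<inter> X k else cell ps bs - X k) = m) \<or>
        (\<forall>m. finite {k\<in>K. \<not> big m (if b then cell ps bs \<inter> X k else cell ps bs - X k)})" for b
      using K_S[of "b # bs"] True unfolding cell_Cons by (simp add: S_def)
    then show ?thesis
      by (rule limit_of_subsets[OF cell_mem[OF ps] X K]) blast
  next
    case False
    then show ?thesis
      using empty_mem by (auto simp: cell_eq_empty near_refl)
  qed
  then have "\<forall>bs. \<exists>Y. Y \<in> \<C> \<and> ?lim bs Y" by blast
  from choice[OF this] obtain Y where "\<And>bs. Y bs \<in> \<C> \<and> ?lim bs (Y bs)" by blast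
  then have Y: "\<And>bs. Y bs \<in> \<C>" "\<And>bs. Y bs \<subseteq> cell ps bs"
      "\<And>bs N. finite {k\<in>K. \<not> near N (cell ps bs \<inter> X k) (Y bs)}"
      "\<And>bs N. finite {k\<in>K. \<not> near N (cell ps bs - X k) (cell ps bs - Y bs)}"
    by blast+
  obtain Z where Z: "Z \<in> \<C>"
    "\<And>b bs. cell (Z # ps) (b # bs) = (if b then Y bs else cell ps bs - Y bs)"
    by (rule glue_cells[OF ps Y(1,2)]) (rule that)
  have fin: "finite {k\<in>K. \<not> near N (cell (X k # ps) cs) (cell (Z # ps) cs)}" for N cs
    using Y(3,4) Z(2) by (cases cs) (simp_all add: cell_eq_empty near_refl cell_Cons)
  have "sat \<C> (\<subseteq>) (Z # ps) \<phi>" if "\<phi> \<in> p" for \<phi>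
  proof -
    let ?N = "2 ^ qrank \<phi>"
    \<comment> \<open>Indices at which \<open>\<phi>\<close> is not yet in force, or some cell is
      not yet near enough to its limit. They are finite in number, so some \<open>k\<close> in
      \<open>K\<close> remains, and there \<open>sat_near\<close> carries \<open>\<phi>\<close> from
      \<open>X k\<close> to \<open>Z\<close>.\<close>
    let ?bad = "{..<to_nat \<phi>} \<union> (\<Union>cs\<in>S. {k\<in>K. \<not> near ?N (cell (X k # ps) cs) (cell (Z # ps) cs)})"
    have "finite ?bad"
      using fin fin_S by (intro finite_UnI finite_UN_I) simp_all
    then have "infinite (K - ?bad)"
      using K by (rule Diff_infinite_finite)
    then have "\<exists>k. k \<in> K - ?bad"
      unfolding ex_in_conv by (rule infinite_imp_nonempty)
    then obtain k where "k \<in> K - ?bad" ..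
    then have k: "k \<in> K" "to_nat \<phi> \<le> k"
      "\<And>cs. cs \<in> S \<Longrightarrow> near ?N (cell (X k # ps) cs) (cell (Z # ps) cs)"
      by auto
    have "near ?N (cell (X k # ps) cs) (cell (Z # ps) cs)" for cs
      using k(3) by (cases "cs \<in> S") (auto simp: S_def cell_eq_empty near_refl)
    then show ?thesis
      using sat_near[of "X k # ps" "Z # ps" \<phi>] sat_X[OF that k(2)] that X Z(1) ps p by simp
  qed
  with Z(1) show "\<exists>X\<in>\<C>. \<forall>\<phi>\<in>p. sat \<C> (\<subseteq>) (X # ps) \<phi>" by blast
qed

end

section \<open>Definable predicates in models of GBC\<close>

context gbc_model
begin

abbreviation V :: "'a set" where
  "V \<equiv> sets_of M E"

definition El :: "'a \<Rightarrow> 'a set" where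
  "El a = {x \<in> M. E x a}"

lemma V_subset_M: "x \<in> V \<Longrightarrow> x \<in> M"
  by (simp add: sets_of_def)

lemma El_subset_V: "a \<in> M \<Longrightarrow> El a \<subseteq> V"
  by (auto simp: El_def sets_of_def)

lemma mem_El_iff: "x \<in> V \<Longrightarrow> x \<in> El a \<longleftrightarrow> E x a"
  by (simp add: El_def V_subset_M)

lemma El_inject: "a \<in> M \<Longrightarrow> b \<in> M \<Longrightarrow> El a = El b \<longleftrightarrow> a = b"
  using extensionality by (auto simp: El_def)

lemma incl_iff: "incl M E a b \<longleftrightarrow> El a \<subseteq> El b"
  by (auto simp: incl_def El_def)

text \<open>
  Definability without parameters, of predicates whose variables range over classes but whose
  quantifiers range over sets. Indices of the formula become arguments of the environment,
  so that a predicate of fixed arity is written with \<open>\<rho> 0\<close>, \<open>\<rho> (Suc 0)\<close>, and so on.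
\<close>

definition dfn :: "((nat \<Rightarrow> 'a) \<Rightarrow> bool) \<Rightarrow> bool" where
  "dfn P \<longleftrightarrow> (\<exists>\<phi> N. \<forall>n\<ge>N. vars_below n \<phi> \<and>
     (\<forall>\<rho>. range \<rho> \<subseteq> M \<longrightarrow> (P \<rho> \<longleftrightarrow> sat V E (map \<rho> [0..<n]) \<phi>)))"

lemma dfn_mem: "dfn (\<lambda>\<rho>. E (\<rho> i) (\<rho> j))"
  unfolding dfn_def by (intro exI[of _ "FRel i j"] exI[of _ "Suc (max i j)"]) auto

lemma dfn_eq: "dfn (\<lambda>\<rho>. \<rho> i = \<rho> j)"
  unfolding dfn_def by (intro exI[of _ "FEq i j"] exI[of _ "Suc (max i j)"]) auto

lemma dfn_not:
  assumes "dfn P"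
  shows "dfn (\<lambda>\<rho>. \<not> P \<rho>)"
proof -
  obtain \<phi> N where "\<forall>n\<ge>N. vars_below n \<phi> \<and>
      (\<forall>\<rho>. range \<rho> \<subseteq> M \<longrightarrow> (P \<rho> \<longleftrightarrow> sat V E (map \<rho> [0..<n]) \<phi>))"
    using assms unfolding dfn_def by blast
  then show ?thesis
    unfolding dfn_def by (intro exI[of _ "FNot \<phi>"] exI[of _ N]) simp
qed

lemma dfn_conj:
  assumes "dfn P" "dfn Q"
  shows "dfn (\<lambda>\<rho>. P \<rho> \<and> Q \<rho>)"
proof -
  obtain \<phi> N where "\<forall>n\<ge>N. vars_below n \<phi> \<and>
      (\<forall>\<rho>. range \<rho> \<subseteq> M \<longrightarrow> (P \<rho> \<longleftrightarrow> sat V E (map \<rho> [0..<n]) \<phi>))"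
    using assms(1) unfolding dfn_def by blast
  moreover obtain \<psi> N' where "\<forall>n\<ge>N'. vars_below n \<psi> \<and>
      (\<forall>\<rho>. range \<rho> \<subseteq> M \<longrightarrow> (Q \<rho> \<longleftrightarrow> sat V E (map \<rho> [0..<n]) \<psi>))"
    using assms(2) unfolding dfn_def by blast
  ultimately show ?thesis
    unfolding dfn_def by (intro exI[of _ "FAnd \<phi> \<psi>"] exI[of _ "max N N'"]) auto
qed

lemma dfn_Bex:
  assumes "dfn (\<lambda>\<rho>. P (\<rho> 0) (\<lambda>i. \<rho> (Suc i)))"
  shows "dfn (\<lambda>\<rho>. \<exists>x\<in>V. P x \<rho>)"
proof -
  obtain \<phi> N where \<phi>: "\<And>n. n \<ge> N \<Longrightarrow> vars_below n \<phi>"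
    and sat: "\<And>n \<rho>. n \<ge> N \<Longrightarrow> range \<rho> \<subseteq> M \<Longrightarrow>
      P (\<rho> 0) (\<lambda>i. \<rho> (Suc i)) \<longleftrightarrow> sat V E (map \<rho> [0..<n]) \<phi>"
    using assms unfolding dfn_def by metis
  have "P x \<rho> \<longleftrightarrow> sat V E (x # map \<rho> [0..<n]) \<phi>" if "n \<ge> N" "range \<rho> \<subseteq> M" "x \<in> V" for n x \<rho>
  proof -
    \<comment> \<open>\<open>case_nat x \<rho>\<close> is the environment with \<open>x\<close> in
      front, matching the index that \<open>FEx\<close> binds.\<close>
    have "range (case_nat x \<rho>) \<subseteq> M"
      using that V_subset_M by (auto simp: image_subset_iff split: nat.split)
    moreover have "map (case_nat x \<rho>) [0..<Suc n] = x # map \<rho> [0..<n]"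
      by (simp add: map_upt_Suc del: upt_Suc)
    ultimately show ?thesis
      using sat[of "Suc n" "case_nat x \<rho>"] that by simp
  qed
  with \<phi> show ?thesis
    unfolding dfn_def by (intro exI[of _ "FEx \<phi>"] exI[of _ N]) auto
qed

lemma dfn_disj: "dfn P \<Longrightarrow> dfn Q \<Longrightarrow> dfn (\<lambda>\<rho>. P \<rho> \<or> Q \<rho>)"
  using dfn_not[OF dfn_conj[OF dfn_not dfn_not, of P Q]] by simp

lemma dfn_imp: "dfn P \<Longrightarrow> dfn Q \<Longrightarrow> dfn (\<lambda>\<rho>. P \<rho> \<longrightarrow> Q \<rho>)"
  using dfn_not[OF dfn_conj[OF _ dfn_not, of P Q]] by simp

lemma dfn_iff: "dfn P \<Longrightarrow> dfn Q \<Longrightarrow> dfn (\<lambda>\<rho>. P \<rho> \<longleftrightarrow> Q \<rho>)"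
  using dfn_conj[OF dfn_imp[of P Q] dfn_imp[of Q P]] by (simp add: iff_conv_conj_imp)

lemma dfn_Ball:
  assumes "dfn (\<lambda>\<rho>. P (\<rho> 0) (\<lambda>i. \<rho> (Suc i)))"
  shows "dfn (\<lambda>\<rho>. \<forall>x\<in>V. P x \<rho>)"
  using dfn_not[OF dfn_Bex[of "\<lambda>x \<rho>. \<not> P x \<rho>", OF dfn_not[OF assms]]] by simp

lemmas dfn_logic = dfn_not dfn_conj dfn_disj dfn_imp dfn_iff dfn_Bex dfn_Ball dfn_mem dfn_eq

text \<open>The first \<open>N\<close> values of \<open>\<sigma>\<close> become the class parameters
  of the scheme; index 0 is left for the element.\<close>

lemma comprehension:
  assumes "dfn (\<lambda>\<rho>. P (\<rho> 0) (\<lambda>i. \<rho> (Suc i)))" "range \<sigma> \<subseteq> M"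
  shows "\<exists>a\<in>M. El a = {x \<in> V. P x \<sigma>}"
proof -
  obtain \<phi> N where \<phi>: "vars_below (Suc N) \<phi>"
    and sat: "\<And>\<rho>. range \<rho> \<subseteq> M \<Longrightarrow>
      P (\<rho> 0) (\<lambda>i. \<rho> (Suc i)) \<longleftrightarrow> sat V E (map \<rho> [0..<Suc N]) \<phi>"
    using assms unfolding dfn_def by (metis le_SucI le_refl)
  let ?ps = "map \<sigma> [0..<N]"
  have "P x \<sigma> \<longleftrightarrow> sat V E (x # ?ps) \<phi>" if "x \<in> V" for x
  proof -
    have "range (case_nat x \<sigma>) \<subseteq> M"
      using that assms(2) V_subset_M by (auto simp: image_subset_iff split: nat.split)
    moreover have "map (case_nat x \<sigma>) [0..<Suc N] = x # ?ps"
      by (simp add: map_upt_Suc del: upt_Suc)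
    ultimately show ?thesis
      using sat[of "case_nat x \<sigma>"] by simp
  qed
  moreover obtain a where "a \<in> M" "\<forall>x\<in>V. E x a \<longleftrightarrow> sat V E (x # ?ps) \<phi>"
    using class_comprehension[rule_format, of ?ps \<phi>] \<phi> assms(2) by auto
  ultimately show ?thesis
    using El_subset_V[of a] by (intro bexI[of _ a]) (auto simp: mem_El_iff)
qed

lemma comprehension3:
  assumes "\<And>i j k l. dfn (\<lambda>\<rho>. P (\<rho> i) (\<rho> j) (\<rho> k) (\<rho> l))"
    and "a \<in> M" "b \<in> M" "c \<in> M"
  shows "\<exists>d\<in>M. El d = {x \<in> V. P x a b c}"
proof -
  have "range (\<lambda>i :: nat. if i = 0 then a else if i = Suc 0 then b else c) \<subseteq> M"
    using assms by auto
  from comprehension[of "\<lambda>x \<rho>. P x (\<rho> 0) (\<rho> (Suc 0)) (\<rho> (Suc (Suc 0)))", OF assms(1) this]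
  show ?thesis by simp
qed

lemma comprehension2:
  assumes "\<And>i j k. dfn (\<lambda>\<rho>. P (\<rho> i) (\<rho> j) (\<rho> k))" "a \<in> M" "b \<in> M"
  shows "\<exists>d\<in>M. El d = {x \<in> V. P x a b}"
  using comprehension3[of "\<lambda>x a b _. P x a b" a b b] assms by simp

lemma comprehension1:
  assumes "\<And>i j. dfn (\<lambda>\<rho>. P (\<rho> i) (\<rho> j))" "a \<in> M"
  shows "\<exists>d\<in>M. El d = {x \<in> V. P x a}"
  using comprehension2[of "\<lambda>x a _. P x a" a a] assms by simp

lemma El_Diff: "a \<in> M \<Longrightarrow> b \<in> M \<Longrightarrow> \<exists>c\<in>M. El c = El a - El b"
proof -
  assume ab: "a \<in> M" "b \<in> M"
  have "\<exists>c\<in>M. El c = {x \<in> V. E x a \<and> \<not> E x b}"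
    by (rule comprehension2[OF _ ab]) (intro dfn_logic)
  moreover have "{x \<in> V. E x a \<and> \<not> E x b} = El a - El b"
    using El_subset_V[OF ab(1)] by (auto simp: mem_El_iff)
  ultimately show ?thesis by simp
qed

lemma El_V: "\<exists>a\<in>M. El a = V"
proof -
  obtain a where "a \<in> M" using infinity V_subset_M by blast
  then show ?thesis
    using comprehension1[of "\<lambda>x _. x = x" a, OF dfn_eq] by simp
qed

section \<open>Sets in models of GBC\<close>

lemma is_upair_iff: "x \<in> V \<Longrightarrow> y \<in> V \<Longrightarrow> is_upair M E p x y \<longleftrightarrow> El p = {x, y}"
  using V_subset_M by (auto simp: is_upair_def El_def)

lemma is_upair_V: "is_upair M E p x y \<Longrightarrow> p \<in> M \<Longrightarrow> x \<in> M \<Longrightarrow> y \<in> M \<Longrightarrow> x \<in> V \<and> y \<in> V"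
  by (auto simp: is_upair_def sets_of_def)

lemma pairing_El: "x \<in> V \<Longrightarrow> y \<in> V \<Longrightarrow> \<exists>p\<in>V. El p = {x, y}"
  using pairing by (metis is_upair_iff)

text \<open>\<open>upr\<close>, \<open>opr\<close> and \<open>mp\<close> are the pair and
  application predicates of the axioms with quantifiers restricted to sets, as predicative
  comprehension requires.\<close>

definition upr :: "'a \<Rightarrow> 'a \<Rightarrow> 'a \<Rightarrow> bool" where
  "upr p x y \<longleftrightarrow> (\<forall>w\<in>V. E w p \<longleftrightarrow> w = x \<or> w = y)"

definition opr :: "'a \<Rightarrow> 'a \<Rightarrow> 'a \<Rightarrow> bool" where
  "opr p x y \<longleftrightarrow> (\<exists>u\<in>V. \<exists>v\<in>V. upr u x x \<and> upr v x y \<and> upr p u v)"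

definition mp :: "'a \<Rightarrow> 'a \<Rightarrow> 'a \<Rightarrow> bool" where
  "mp F x y \<longleftrightarrow> (\<exists>p\<in>V. opr p x y \<and> E p F)"

lemma dfn_upr: "dfn (\<lambda>\<rho>. upr (\<rho> i) (\<rho> j) (\<rho> k))"
  unfolding upr_def by (intro dfn_logic)

lemma dfn_opr: "dfn (\<lambda>\<rho>. opr (\<rho> i) (\<rho> j) (\<rho> k))"
  unfolding opr_def by (intro dfn_logic dfn_upr)

lemma dfn_mp: "dfn (\<lambda>\<rho>. mp (\<rho> i) (\<rho> j) (\<rho> k))"
  unfolding mp_def by (intro dfn_logic dfn_opr)

lemma upr_iff: "p \<in> M \<Longrightarrow> x \<in> V \<Longrightarrow> y \<in> V \<Longrightarrow> upr p x y \<longleftrightarrow> El p = {x, y}"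
proof -
  assume p: "p \<in> M" and xy: "x \<in> V" "y \<in> V"
  have "upr p x y \<longleftrightarrow> (\<forall>w\<in>V. w \<in> El p \<longleftrightarrow> w \<in> {x, y})"
    by (simp add: upr_def mem_El_iff)
  also have "\<dots> \<longleftrightarrow> El p = {x, y}"
    using El_subset_V[OF p] xy by blast
  finally show ?thesis .
qed

lemma opr_iff: "p \<in> M \<Longrightarrow> x \<in> V \<Longrightarrow> y \<in> V \<Longrightarrow>
    opr p x y \<longleftrightarrow> (\<exists>u\<in>V. \<exists>v\<in>V. El u = {x} \<and> El v = {x, y} \<and> El p = {u, v})"
  by (simp add: opr_def upr_iff V_subset_M)

lemma opr_exists:
  assumes "x \<in> V" "y \<in> V"
  shows "\<exists>p\<in>V. opr p x y"
proof -
  obtain u v where "u \<in> V" "El u = {x, x}" "v \<in> V" "El v = {x, y}"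
    using pairing_El assms by meson
  moreover obtain p where "p \<in> V" "El p = {u, v}"
    using pairing_El calculation by meson
  ultimately show ?thesis
    using assms by (auto simp: opr_iff V_subset_M)
qed

lemma opr_inject:
  assumes "p \<in> M" "x \<in> V" "y \<in> V" "x' \<in> V" "y' \<in> V" "opr p x y" "opr p x' y'"
  shows "x = x' \<and> y = y'"
proof -
  obtain u v where uv: "u \<in> V" "v \<in> V" "El u = {x}" "El v = {x, y}" "El p = {u, v}"
    using assms by (auto simp: opr_iff)
  obtain u' v' where uv': "u' \<in> V" "v' \<in> V" "El u' = {x'}" "El v' = {x', y'}" "El p = {u', v'}"
    using assms by (auto simp: opr_iff)
  have "{u, v} = {u', v'}" using uv uv' by simp
  then have "u = u' \<and> v = v' \<or> u = v' \<and> v = u'" by (simp add: doubleton_eq_iff)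
  then show ?thesis
    using uv uv' by (auto simp: doubleton_eq_iff)
qed

text \<open>The quantifiers over classes may be restricted to sets because every object involved is
  an element: \<open>p\<close> of \<open>F\<close>, \<open>u\<close> and \<open>v\<close> of
  \<open>p\<close>, and \<open>x\<close> and \<open>y\<close> of \<open>v\<close>.\<close>

lemma maps_to_iff:
  assumes "F \<in> M" "x \<in> M" "y \<in> M"
  shows "maps_to M E F x y \<longleftrightarrow> x \<in> V \<and> y \<in> V \<and> mp F x y"
proof
  assume "maps_to M E F x y"
  then obtain p u v where p: "p \<in> M" "E p F" "u \<in> M" "v \<in> M"
      "is_upair M E u x x" "is_upair M E v x y" "is_upair M E p u v"
    unfolding maps_to_def is_opair_def by blast
  then have V: "x \<in> V" "y \<in> V" "u \<in> V" "v \<in> V" "p \<in> V"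
    using assms is_upair_V by (auto simp: sets_of_def)
  then have "El u = {x}" "El v = {x, y}" "El p = {u, v}"
    using p by (auto simp: is_upair_iff)
  then have "opr p x y"
    using V p(1) by (auto simp: opr_iff)
  with V p(2) show "x \<in> V \<and> y \<in> V \<and> mp F x y"
    by (auto simp: mp_def)
next
  assume *: "x \<in> V \<and> y \<in> V \<and> mp F x y"
  then obtain p where p: "p \<in> V" "E p F" "opr p x y"
    by (auto simp: mp_def)
  then obtain u v where "u \<in> V" "v \<in> V" "El u = {x, x}" "El v = {x, y}" "El p = {u, v}"
    using * V_subset_M[OF p(1)] by (auto simp: opr_iff)
  with * p show "maps_to M E F x y"
    unfolding maps_to_def is_opair_def by (meson V_subset_M is_upair_iff)
qed

lemma class_of_pairs:
  assumes "\<And>i j k l. dfn (\<lambda>\<rho>. R (\<rho> i) (\<rho> j) (\<rho> k) (\<rho> l))"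
    and ab: "a \<in> M" "b \<in> M"
  shows "\<exists>F\<in>M. \<forall>x\<in>V. \<forall>y\<in>V. mp F x y \<longleftrightarrow> R x y a b"
proof -
  have "\<exists>F\<in>M. El F = {p \<in> V. \<exists>x\<in>V. \<exists>y\<in>V. opr p x y \<and> R x y a b}"
    by (rule comprehension2[of "\<lambda>p a b. \<exists>x\<in>V. \<exists>y\<in>V. opr p x y \<and> R x y a b"])
      (intro dfn_logic dfn_opr assms(1) ab)+
  then obtain F where F: "F \<in> M" "El F = {p \<in> V. \<exists>x\<in>V. \<exists>y\<in>V. opr p x y \<and> R x y a b}" by blast
  have "mp F x y \<longleftrightarrow> R x y a b" if xy: "x \<in> V" "y \<in> V" for x y
  proof
    assume "mp F x y"
    then obtain p where "p \<in> El F" "opr p x y"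
      using mem_El_iff unfolding mp_def by blast
    then show "R x y a b"
      using F(2) opr_inject[of p x y] xy V_subset_M by blast
  next
    assume "R x y a b"
    moreover obtain p where "p \<in> V" "opr p x y" using opr_exists[OF xy] by blast
    moreover have "p \<in> El F" using F(2) xy calculation by blast
    ultimately show "mp F x y" by (auto simp: mp_def mem_El_iff)
  qed
  with F(1) show ?thesis by blast
qed

lemma replacement_El:
  assumes F: "F \<in> M" and "a \<in> V"
    and sv: "\<And>x y z. x \<in> V \<Longrightarrow> y \<in> V \<Longrightarrow> z \<in> V \<Longrightarrow> mp F x y \<Longrightarrow> mp F x z \<Longrightarrow> y = z"
  shows "\<exists>b\<in>V. El b = {y \<in> V. \<exists>x\<in>El a. mp F x y}"
proof -
  have "single_valued_class M E F"
    using sv by (auto simp: single_valued_class_def maps_to_iff[OF F])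
  then obtain b where "b \<in> V" "\<forall>y\<in>M. E y b \<longleftrightarrow> (\<exists>x\<in>M. E x a \<and> maps_to M E F x y)"
    using replacement F \<open>a \<in> V\<close> by blast
  moreover have "El a \<subseteq> V"
    using El_subset_V[OF V_subset_M[OF \<open>a \<in> V\<close>]] .
  ultimately have "El b = {y \<in> V. \<exists>x\<in>El a. mp F x y}"
    unfolding El_def using maps_to_iff[OF F] V_subset_M by blast
  with \<open>b \<in> V\<close> show ?thesis by blast
qed

text \<open>Replacement along the identity map restricted to \<open>c\<close>.\<close>

lemma separation:
  assumes "a \<in> V" "c \<in> M"
  shows "\<exists>b\<in>V. El b = El a \<inter> El c"
proof -
  have "\<exists>F\<in>M. \<forall>x\<in>V. \<forall>y\<in>V. mp F x y \<longleftrightarrow> x = y \<and> E x c"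
    by (rule class_of_pairs[of "\<lambda>x y c _. x = y \<and> E x c", OF _ assms(2) assms(2)]) (intro dfn_logic)
  then obtain F where F: "F \<in> M" "\<And>x y. x \<in> V \<Longrightarrow> y \<in> V \<Longrightarrow> mp F x y \<longleftrightarrow> x = y \<and> E x c" by blast
  then obtain b where b: "b \<in> V" "El b = {y \<in> V. \<exists>x\<in>El a. mp F x y}"
    using replacement_El[OF F(1) assms(1)] by (auto simp: F(2))
  moreover have "El b = El a \<inter> El c"
    using b(2) F(2) El_subset_V[OF V_subset_M[OF assms(1)]] by (auto simp: El_def V_subset_M subset_iff)
  ultimately show ?thesis by blast
qed

lemma set_of_subclass:
  assumes "a \<in> V" "c \<in> M" "El c \<subseteq> El a"
  shows "c \<in> V"
  using separation[OF assms(1,2)] assms El_inject V_subset_M by (metis Int_absorb1)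

lemma union_El: "a \<in> V \<Longrightarrow> \<exists>u\<in>V. El u = (\<Union>y\<in>El a. El y)"
proof -
  assume a: "a \<in> V"
  obtain u where u: "u \<in> V" "\<forall>w\<in>M. E w u \<longleftrightarrow> (\<exists>y\<in>M. E w y \<and> E y a)"
    using union a by blast
  then have "El u = (\<Union>y\<in>El a. El y)"
    unfolding El_def by blast
  with u(1) show ?thesis by blast
qed

lemma power_set_El:
  assumes "a \<in> V"
  shows "\<exists>p\<in>V. El p = {w \<in> V. El w \<subseteq> El a}"
proof -
  obtain p where "p \<in> V" "\<forall>w\<in>V. E w p \<longleftrightarrow> incl M E w a"
    using power_set assms by blast
  then show ?thesis
    using El_subset_V[OF V_subset_M[of p]] mem_El_iff unfolding incl_iff by blast
qed

lemma empty_El: "\<exists>z\<in>V. El z = {}"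
proof -
  obtain a z where "a \<in> V" "z \<in> M" "E z a" "\<forall>w\<in>M. \<not> E w z"
    using infinity by blast
  then show ?thesis
    using V_subset_M[OF \<open>a \<in> V\<close>] unfolding El_def sets_of_def by blast
qed

lemma insert_El:
  assumes "x \<in> V" "a \<in> V"
  shows "\<exists>b\<in>V. El b = insert x (El a)"
proof -
  obtain s where s: "s \<in> V" "El s = {x, x}" using pairing_El assms by blast
  obtain p where p: "p \<in> V" "El p = {s, a}" using pairing_El s assms by blast
  show ?thesis using union_El[OF p(1)] p(2) s(2) by simp
qed

lemma foundation_El: "a \<in> M \<Longrightarrow> El a \<noteq> {} \<Longrightarrow> \<exists>x\<in>El a. El x \<inter> El a = {}"
  using foundation by (fastforce simp: El_def)

text \<open>A membership-minimal counterexample contradicts the induction step. Foundation applies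
  because the first hypothesis makes the counterexamples a class.\<close>

lemma mem_induct:
  assumes "\<exists>c\<in>M. El c = {x \<in> V. \<not> P x}"
    and "\<And>x. x \<in> V \<Longrightarrow> (\<And>y. y \<in> El x \<Longrightarrow> P y) \<Longrightarrow> P x"
  shows "x \<in> V \<Longrightarrow> P x"
proof (rule ccontr)
  assume x: "x \<in> V" "\<not> P x"
  obtain c where c: "c \<in> M" "El c = {x \<in> V. \<not> P x}" using assms(1) by blast
  then obtain y where y: "y \<in> El c" "El y \<inter> El c = {}"
    using foundation_El[of c] x by blast
  then have "P z" if "z \<in> El y" for z
    using that c El_subset_V[of y] V_subset_M by blast
  with assms(2)[of y] y c show False by blast
qed

section \<open>Levels of the cumulative hierarchy\<close>

text \<open>
  Levels are introduced without ordinals, following Button's variant of the theories of Scott and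
  Potter: \<open>pot A\<close> is the union of the power sets of the elements of \<open>A\<close>, a history is
  a set \<open>h\<close> with \<open>x = pot (x \<inter> h)\<close> for all its elements \<open>x\<close>, and the levels are
  the sets \<open>pot h\<close> for histories \<open>h\<close>.
\<close>

definition sub :: "'a \<Rightarrow> 'a \<Rightarrow> bool" where
  "sub a b \<longleftrightarrow> (\<forall>w\<in>V. E w a \<longrightarrow> E w b)"

definition hist :: "'a \<Rightarrow> bool" where
  "hist h \<longleftrightarrow> (\<forall>x\<in>V. E x h \<longrightarrow> (\<forall>z\<in>V. E z x \<longleftrightarrow> (\<exists>y\<in>V. E y x \<and> E y h \<and> sub z y)))"

definition level :: "'a \<Rightarrow> bool" where
  "level s \<longleftrightarrow> (\<exists>h\<in>V. hist h \<and> (\<forall>z\<in>V. E z s \<longleftrightarrow> (\<exists>y\<in>V. E y h \<and> sub z y)))"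

definition trans :: "'a \<Rightarrow> bool" where
  "trans x \<longleftrightarrow> (\<forall>y\<in>V. E y x \<longrightarrow> sub y x)"

definition pot :: "'a set \<Rightarrow> 'a set" where
  "pot A = {z \<in> V. \<exists>y\<in>A. El z \<subseteq> El y}"

lemma dfn_sub: "dfn (\<lambda>\<rho>. sub (\<rho> i) (\<rho> j))"
  unfolding sub_def by (intro dfn_logic)

lemma dfn_hist: "dfn (\<lambda>\<rho>. hist (\<rho> i))"
  unfolding hist_def by (intro dfn_logic dfn_sub)

lemma dfn_level: "dfn (\<lambda>\<rho>. level (\<rho> i))"
  unfolding level_def by (intro dfn_logic dfn_sub dfn_hist)

lemma dfn_trans: "dfn (\<lambda>\<rho>. trans (\<rho> i))"
  unfolding trans_def by (intro dfn_logic dfn_sub)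

lemma El_in_V: "a \<in> V \<Longrightarrow> x \<in> El a \<Longrightarrow> x \<in> V"
  using El_subset_V V_subset_M by blast

lemma El_inject_V: "a \<in> V \<Longrightarrow> b \<in> V \<Longrightarrow> El a = El b \<Longrightarrow> a = b"
  using El_inject V_subset_M by blast

lemma Ball_El: "a \<in> V \<Longrightarrow> (\<forall>x\<in>V. E x a \<longrightarrow> P x) \<longleftrightarrow> (\<forall>x\<in>El a. P x)"
  using El_in_V mem_El_iff by blast

lemma Bex_El: "a \<in> V \<Longrightarrow> (\<exists>x\<in>V. E x a \<and> P x) \<longleftrightarrow> (\<exists>x\<in>El a. P x)"
  using El_in_V mem_El_iff by blast

lemma El_eq_iff: "a \<in> V \<Longrightarrow> B \<subseteq> V \<Longrightarrow> El a = B \<longleftrightarrow> (\<forall>x\<in>V. E x a \<longleftrightarrow> x \<in> B)"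
  using El_in_V mem_El_iff by blast

lemma sub_iff: "a \<in> V \<Longrightarrow> sub a b \<longleftrightarrow> El a \<subseteq> El b"
  using El_in_V mem_El_iff unfolding sub_def by blast

lemma trans_iff: "x \<in> V \<Longrightarrow> trans x \<longleftrightarrow> (\<forall>y\<in>El x. El y \<subseteq> El x)"
  using El_in_V mem_El_iff sub_iff unfolding trans_def by metis

lemma potI: "z \<in> V \<Longrightarrow> y \<in> A \<Longrightarrow> El z \<subseteq> El y \<Longrightarrow> z \<in> pot A"
  by (auto simp: pot_def)

lemma pot_iff: "pot A \<subseteq> V" "z \<in> V \<Longrightarrow> z \<in> pot A \<longleftrightarrow> (\<exists>y\<in>A. El z \<subseteq> El y)"
  by (auto simp: pot_def)

lemma hist_iff:
  assumes "h \<in> V"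
  shows "hist h \<longleftrightarrow> (\<forall>x\<in>El h. El x = pot (El x \<inter> El h))"
proof -
  have "(\<forall>z\<in>V. E z x \<longleftrightarrow> (\<exists>y\<in>V. E y x \<and> E y h \<and> sub z y)) \<longleftrightarrow> El x = pot (El x \<inter> El h)"
    if "x \<in> El h" for x
  proof -
    have x: "x \<in> V" using El_in_V[OF assms that] .
    have "(\<exists>y\<in>V. E y x \<and> E y h \<and> sub z y) \<longleftrightarrow> z \<in> pot (El x \<inter> El h)" if "z \<in> V" for z
      unfolding Bex_El[OF x] pot_iff(2)[OF that] sub_iff[OF that]
      by (auto simp: El_def)
    then show ?thesis
      by (simp add: El_eq_iff[OF x pot_iff(1)])
  qed
  then show ?thesis
    unfolding hist_def Ball_El[OF assms] by simp
qed

lemma level_iff: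
  assumes "s \<in> V"
  shows "level s \<longleftrightarrow> (\<exists>h\<in>V. hist h \<and> El s = pot (El h))"
  unfolding level_def El_eq_iff[OF assms pot_iff(1)] by (simp add: Bex_El sub_iff pot_iff(2))

text \<open>By membership induction. The elements \<open>w\<close> of \<open>x \<inter> h\<close>
  are transitive, hence subsets of \<open>x = pot (x \<inter> h)\<close>, and every element of
  \<open>x\<close> is included in such a \<open>w\<close>.\<close>

lemma hist_trans:
  assumes h: "h \<in> V" "hist h"
  shows "x \<in> V \<Longrightarrow> E x h \<longrightarrow> trans x"
proof (rule mem_induct[where P = "\<lambda>x. E x h \<longrightarrow> trans x"])
  show "\<exists>c\<in>M. El c = {x \<in> V. \<not> (E x h \<longrightarrow> trans x)}"
    by (rule comprehension1[OF _ V_subset_M[OF h(1)]]) (intro dfn_logic dfn_trans)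
next
  fix x
  assume x: "x \<in> V" and IH: "\<And>y. y \<in> El x \<Longrightarrow> E y h \<longrightarrow> trans y"
  show "E x h \<longrightarrow> trans x"
  proof
    assume "E x h"
    then have x_pot: "El x = pot (El x \<inter> El h)"
      using h x by (simp add: hist_iff mem_El_iff)
    have sub: "El w \<subseteq> El x" if w: "w \<in> El x \<inter> El h" for w
    proof
      fix q
      assume q: "q \<in> El w"
      have "trans w" "w \<in> V"
        using IH[of w] w x El_in_V by (auto simp: El_def)
      then have "El q \<subseteq> El w" "q \<in> V"
        using q El_in_V by (auto simp: trans_iff)
      then show "q \<in> El x"
        using x_pot[THEN equalityD2, THEN subsetD, OF potI[of q w]] w by simp
    qed
    have "El y \<subseteq> El x" if y: "y \<in> El x" for y
    proof -
      obtain w where "w \<in> El x \<inter> El h" "El y \<subseteq> El w"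
        using x_pot[THEN equalityD1, THEN subsetD, OF y] unfolding pot_def by blast
      with sub show ?thesis by blast
    qed
    then show "trans x" by (simp add: trans_iff x)
  qed
qed

lemma pot_down: "y \<in> pot A \<Longrightarrow> z \<in> V \<Longrightarrow> El z \<subseteq> El y \<Longrightarrow> z \<in> pot A"
  unfolding pot_def by blast

lemma level_down: "s \<in> V \<Longrightarrow> level s \<Longrightarrow> y \<in> El s \<Longrightarrow> z \<in> V \<Longrightarrow> El z \<subseteq> El y \<Longrightarrow> z \<in> El s"
  by (metis pot_down level_iff)

lemma level_trans:
  assumes "s \<in> V" "level s" "y \<in> El s"
  shows "El y \<subseteq> El s"
proof
  fix z
  assume z: "z \<in> El y"
  obtain h where h: "h \<in> V" "hist h" "El s = pot (El h)"
    using assms level_iff by blast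
  then have "y \<in> pot (El h)" using assms(3) by simp
  then obtain w where w: "w \<in> El h" "El y \<subseteq> El w" "w \<in> V" "y \<in> V"
    using El_in_V[OF h(1)] unfolding pot_def by blast
  then have "trans w"
    using hist_trans[OF h(1,2), of w] mem_El_iff by blast
  then have "El z \<subseteq> El w" "z \<in> V"
    using w z El_in_V by (auto simp: trans_iff)
  then show "z \<in> El s"
    using h(3) w(1) unfolding pot_def by blast
qed

text \<open>The witness is the initial part \<open>x \<inter> h\<close> of the history: transitivity
  of \<open>x\<close> makes it a history, and \<open>x\<close> is its \<open>pot\<close>.\<close>

lemma hist_mem_level:
  assumes h: "h \<in> V" "hist h" and "x \<in> El h"
  shows "level x"
proof -
  have x: "x \<in> V" using assms El_in_V by blast
  obtain k where k: "k \<in> V" "El k = El x \<inter> El h"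
    using separation x h(1) V_subset_M by meson
  have "trans x"
    using hist_trans[OF h x] assms(3) x mem_El_iff by blast
  then have "El y \<inter> El k = El y \<inter> El h" if "y \<in> El k" for y
    using that k x by (auto simp: trans_iff)
  then have "hist k"
    using h k by (simp add: hist_iff)
  moreover have "El x = pot (El k)"
    using h assms(3) k(2) by (simp add: hist_iff)
  ultimately show ?thesis
    using k(1) x by (auto simp: level_iff)
qed

text \<open>A history for \<open>s\<close> consists of levels and is contained in \<open>s\<close>;
  conversely, \<open>s\<close> contains all subsets of its elements. Hence a level is determined by
  the levels in it.\<close>

lemma level_eq_pot:
  assumes s: "s \<in> V" "level s"
  shows "El s = pot {w \<in> El s. level w}"
proof
  obtain h where h: "h \<in> V" "hist h" "El s = pot (El h)"
    using s level_iff by blast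
  have "El h \<subseteq> El s"
    using h El_in_V[OF h(1)] by (auto simp: pot_def)
  then have "El h \<subseteq> {w \<in> El s. level w}"
    using hist_mem_level[OF h(1,2)] by blast
  then show "El s \<subseteq> pot {w \<in> El s. level w}"
    unfolding h(3) pot_def by blast
  show "pot {w \<in> El s. level w} \<subseteq> El s"
    using level_down[OF s] unfolding pot_def by blast
qed

text \<open>Double membership induction. If \<open>s\<close> and \<open>t\<close> contain the same
  levels, they are equal by \<open>level_eq_pot\<close>. Otherwise a level \<open>w\<close> in one
  but not in the other is comparable with the latter by induction, which puts the latter into the
  former.\<close>

lemma level_linear:
  assumes "s \<in> V" "t \<in> V" "level s" "level t"
  shows "E s t \<or> s = t \<or> E t s"
proof -
  have "\<forall>t\<in>V. level s \<longrightarrow> level t \<longrightarrow> E s t \<or> s = t \<or> E t s"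
  proof (rule mem_induct[where P = "\<lambda>s. \<forall>t\<in>V. level s \<longrightarrow> level t \<longrightarrow> E s t \<or> s = t \<or> E t s", OF _ _ assms(1)])
    show "\<exists>c\<in>M. El c = {s \<in> V. \<not> (\<forall>t\<in>V. level s \<longrightarrow> level t \<longrightarrow> E s t \<or> s = t \<or> E t s)}"
      by (rule comprehension1[OF _ V_subset_M[OF assms(1)]]) (intro dfn_logic dfn_level)
  next
    fix s
    assume s: "s \<in> V"
      and IH: "\<And>w. w \<in> El s \<Longrightarrow> \<forall>t\<in>V. level w \<longrightarrow> level t \<longrightarrow> E w t \<or> w = t \<or> E t w"
    show "\<forall>t\<in>V. level s \<longrightarrow> level t \<longrightarrow> E s t \<or> s = t \<or> E t s"
    proof
      fix t
      assume "t \<in> V"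
      then show "level s \<longrightarrow> level t \<longrightarrow> E s t \<or> s = t \<or> E t s"
      proof (rule mem_induct[where P = "\<lambda>t. level s \<longrightarrow> level t \<longrightarrow> E s t \<or> s = t \<or> E t s", rotated 2])
        show "\<exists>c\<in>M. El c = {t \<in> V. \<not> (level s \<longrightarrow> level t \<longrightarrow> E s t \<or> s = t \<or> E t s)}"
          by (rule comprehension1[OF _ V_subset_M[OF s]]) (intro dfn_logic dfn_level)
      next
        fix t
        assume t: "t \<in> V"
          and IH': "\<And>w. w \<in> El t \<Longrightarrow> level s \<longrightarrow> level w \<longrightarrow> E s w \<or> s = w \<or> E w s"
        show "level s \<longrightarrow> level t \<longrightarrow> E s t \<or> s = t \<or> E t s"
        proof (intro impI)
          assume lev: "level s" "level t"
          consider "{w \<in> El s. level w} = {w \<in> El t. level w}"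
            | w where "w \<in> El s" "level w" "w \<notin> El t" | w where "w \<in> El t" "level w" "w \<notin> El s"
            by blast
          then show "E s t \<or> s = t \<or> E t s"
          proof cases
            case 1
            then have "El s = El t"
              using level_eq_pot[OF s lev(1)] level_eq_pot[OF t lev(2)] by simp
            then show ?thesis using El_inject_V[OF s t] by blast
          next
            case 2
            then have "w = t \<or> t \<in> El w"
              using IH[of w] t lev(2) El_in_V[OF s] mem_El_iff by blast
            then have "t \<in> El s"
              using level_trans[OF s lev(1) 2(1)] 2(1) by blast
            then show ?thesis by (simp add: El_def)
          next
            case 3
            then have "s = w \<or> s \<in> El w"
              using IH'[of w] s lev(1) El_in_V[OF t] mem_El_iff by blast
            then have "s \<in> El t"
              using level_trans[OF t lev(2) 3(1)] 3(1) by blast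
            then show ?thesis by (simp add: El_def)
          qed
        qed
      qed
    qed
  qed
  then show ?thesis using assms by blast
qed

lemma mem_irrefl:
  assumes "x \<in> V"
  shows "\<not> E x x"
proof -
  obtain p where "p \<in> V" "El p = {x, x}" using pairing_El assms by blast
  then have "El x \<inter> {x} = {}"
    using foundation_El[of p] V_subset_M by auto
  then show ?thesis
    using assms mem_El_iff by blast
qed

section \<open>Least levels, and the covering of every set by a level\<close>

definition least_level :: "('a \<Rightarrow> bool) \<Rightarrow> 'a \<Rightarrow> bool" where
  "least_level P s \<longleftrightarrow> level s \<and> P s \<and> (\<forall>t\<in>V. level t \<and> P t \<longrightarrow> s = t \<or> E s t)"

lemma least_level_unique:
  assumes "s \<in> V" "t \<in> V" "least_level P s" "least_level P t"
  shows "s = t"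
proof (rule ccontr)
  assume "s \<noteq> t"
  then have "E s t" "E t s" "level s"
    using assms unfolding least_level_def by blast+
  then have "s \<in> El s"
    using level_trans[of s t] assms mem_El_iff by blast
  then show False
    using mem_irrefl assms mem_El_iff by blast
qed

lemma least_level_exists:
  assumes "\<exists>c\<in>M. El c = {t \<in> V. level t \<and> P t}" "t \<in> V" "level t" "P t"
  shows "\<exists>s\<in>V. least_level P s"
proof -
  obtain c where c: "c \<in> M" "El c = {t \<in> V. level t \<and> P t}" using assms(1) by blast
  then obtain s where s: "s \<in> El c" "El s \<inter> El c = {}"
    using foundation_El[of c] assms by blast
  have "s = t \<or> E s t" if "t \<in> V" "level t" "P t" for t
  proof -
    have "\<not> E t s"
      using that s(2) c(2) mem_El_iff by blast
    then show ?thesis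
      using level_linear[of s t] s(1) c(2) that by blast
  qed
  then show ?thesis
    using s(1) c(2) unfolding least_level_def by blast
qed

text \<open>By induction every \<open>y\<close> in \<open>x\<close> is included in a level.
  Replacement collects the least such levels, which are enlarged to a history; its
  \<open>pot\<close> is a level including \<open>x\<close>.\<close>

lemma level_cover: "x \<in> V \<Longrightarrow> \<exists>s\<in>V. level s \<and> sub x s"
proof (rule mem_induct[where P = "\<lambda>x. \<exists>s\<in>V. level s \<and> sub x s"])
  obtain a where "a \<in> M" using El_V by blast
  show "\<exists>c\<in>M. El c = {x \<in> V. \<not> (\<exists>s\<in>V. level s \<and> sub x s)}"
    by (rule comprehension1[OF _ \<open>a \<in> M\<close>]) (intro dfn_logic dfn_level dfn_sub)
next
  fix x
  assume x: "x \<in> V" and IH: "\<And>y. y \<in> El x \<Longrightarrow> \<exists>s\<in>V. level s \<and> sub y s"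
  have xM: "x \<in> M" using x V_subset_M by blast
  \<comment> \<open>Taking the least level makes the assignment single-valued, as replacement
    demands.\<close>
  have "\<exists>F\<in>M. \<forall>y\<in>V. \<forall>s\<in>V. mp F y s \<longleftrightarrow> least_level (sub y) s"
    unfolding least_level_def by (rule class_of_pairs[OF _ xM xM]) (intro dfn_logic dfn_level dfn_sub)
  then obtain F where F: "F \<in> M" "\<And>y s. y \<in> V \<Longrightarrow> s \<in> V \<Longrightarrow> mp F y s \<longleftrightarrow> least_level (sub y) s"
    by blast
  have "s = t" if "y \<in> V" "s \<in> V" "t \<in> V" "mp F y s" "mp F y t" for y s t
    using that least_level_unique[of s t "sub y"] by (simp add: F(2))
  then obtain b where b: "b \<in> V" "El b = {s \<in> V. \<exists>y\<in>El x. mp F y s}"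
    using replacement_El[OF F(1) x] by blast
  obtain u where u: "u \<in> V" "El u = (\<Union>s\<in>El b. El s)" using union_El[OF b(1)] by blast
  obtain p where p: "p \<in> V" "El p = {b, u}" using pairing_El b(1) u(1) by blast
  obtain v where v: "v \<in> V" "El v = El b \<union> El u" using union_El[OF p(1)] p(2) by auto
  \<comment> \<open>Besides the collected levels, \<open>h\<close> contains all levels lying in one
    of them. So for \<open>w\<close> in \<open>h\<close>, \<open>w \<inter> h\<close> consists of
    all levels in \<open>w\<close>, and \<open>level_eq_pot\<close> shows that \<open>h\<close> is a
    history.\<close>
  have "\<exists>h\<in>M. El h = {w \<in> V. level w \<and> E w v}"
    by (rule comprehension1[OF _ V_subset_M[OF v(1)]]) (intro dfn_logic dfn_level)
  then obtain h where h: "h \<in> M" "El h = {w \<in> V. level w \<and> E w v}" by blast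
  then have h_v: "El h = {w \<in> El v. level w}"
    using El_in_V[OF v(1)] mem_El_iff by blast
  have hV: "h \<in> V"
    by (rule set_of_subclass[OF v(1) h(1)]) (auto simp: h_v)
  have level_b: "level s" if "s \<in> El b" for s
    using that b(2) F(2) El_in_V[OF x] unfolding least_level_def by blast
  have "El w = pot (El w \<inter> El h)" if w: "w \<in> El h" for w
  proof -
    have "q \<in> El v" if q: "q \<in> El w" for q
    proof (cases "w \<in> El b")
      case True
      then show ?thesis using q u(2) v(2) by blast
    next
      case False
      then obtain s where "s \<in> El b" "w \<in> El s"
        using w h_v v(2) u(2) by blast
      then show ?thesis
        using q level_trans[of s w] level_b El_in_V[OF b(1)] u(2) v(2) by blast
    qed
    then have "El w \<inter> El h = {q \<in> El w. level q}"
      using h_v by blast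
    then show ?thesis
      using level_eq_pot[of w] w h(2) by simp
  qed
  then have hist: "hist h"
    using hist_iff[OF hV] by blast
  obtain U where U: "U \<in> V" "El U = (\<Union>y\<in>El h. El y)" using union_El[OF hV] by blast
  \<comment> \<open>The power set of the union of \<open>h\<close> bounds \<open>pot h\<close>,
    which is therefore a set.\<close>
  obtain PU where PU: "PU \<in> V" "El PU = {w \<in> V. El w \<subseteq> El U}" using power_set_El[OF U(1)] by blast
  have "\<exists>s\<in>M. El s = {z \<in> V. \<exists>y\<in>V. E y h \<and> sub z y}"
    by (rule comprehension1[OF _ h(1)]) (intro dfn_logic dfn_sub)
  then obtain s where s: "s \<in> M" "El s = pot (El h)"
    by (auto simp: pot_def sub_iff Bex_El[OF hV] cong: conj_cong)
  have sV: "s \<in> V"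
    by (rule set_of_subclass[OF PU(1) s(1)]) (auto simp: s(2) PU(2) U(2) pot_def)
  have "level s"
    using hV hist s(2) sV level_iff by blast
  moreover have "El x \<subseteq> El s"
  proof
    fix y
    assume y: "y \<in> El x"
    have yV: "y \<in> V" using El_in_V[OF x y] .
    have "\<exists>c\<in>M. El c = {t \<in> V. level t \<and> sub y t}"
      by (rule comprehension1[OF _ V_subset_M[OF yV]]) (intro dfn_logic dfn_level dfn_sub)
    then obtain t where t: "t \<in> V" "least_level (sub y) t"
      using least_level_exists IH[OF y] by blast
    then have "t \<in> El b"
      using b(2) F(2)[OF yV t(1)] y by blast
    then have "t \<in> El h"
      using h_v v(2) level_b by blast
    moreover have "El y \<subseteq> El t"
      using t(2) yV sub_iff unfolding least_level_def by blast
    ultimately show "y \<in> El s"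
      using s(2) yV unfolding pot_def by blast
  qed
  ultimately show "\<exists>s\<in>V. level s \<and> sub x s"
    using sV sub_iff[OF x] by blast
qed

text \<open>
  Scott's trick: a choice function for sets yields a uniform choice from the classes
  \<open>c - m\<close>, because the elements of \<open>c - m\<close> of minimal rank form a set.
\<close>

lemma choice_from_class_complements:
  assumes c: "c \<in> M"
  obtains G where "G \<in> M"
    "\<And>m x y. m \<in> V \<Longrightarrow> x \<in> V \<Longrightarrow> y \<in> V \<Longrightarrow> mp G m x \<Longrightarrow> mp G m y \<Longrightarrow> x = y"
    "\<And>m x. m \<in> V \<Longrightarrow> x \<in> V \<Longrightarrow> mp G m x \<Longrightarrow> x \<in> El c - El m"
    "\<And>m. m \<in> V \<Longrightarrow> El c - El m \<noteq> {} \<Longrightarrow> \<exists>x\<in>V. mp G m x"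
proof -
  obtain F where F: "F \<in> M" "single_valued_class M E F"
    and F_choice: "\<forall>x\<in>V. (\<exists>y\<in>M. E y x) \<longrightarrow> (\<exists>y\<in>M. E y x \<and> maps_to M E F x y)"
    using global_choice by blast
  have F_unique: "y = z" if "x \<in> V" "y \<in> V" "z \<in> V" "mp F x y" "mp F x z" for x y z
    using F(2) that maps_to_iff[OF F(1)] V_subset_M unfolding single_valued_class_def by blast
  define meets where "meets m c t \<longleftrightarrow> (\<exists>y\<in>V. E y c \<and> \<not> E y m \<and> sub y t)" for m c t
  \<comment> \<open>\<open>b\<close> collects the elements of \<open>c - m\<close> that are included
    in the first level including any of them. The value of \<open>G\<close> at \<open>m\<close> will
    be the value of the choice function \<open>F\<close> at this set.\<close>
  define part where "part b m c \<longleftrightarrow> (\<exists>s\<in>V. least_level (meets m c) s \<and>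
      (\<forall>y\<in>V. E y b \<longleftrightarrow> E y c \<and> \<not> E y m \<and> sub y s))" for b m c
  have dfn_meets: "dfn (\<lambda>\<rho>. meets (\<rho> i) (\<rho> j) (\<rho> k))" for i j k
    unfolding meets_def by (intro dfn_logic dfn_sub)
  have dfn_part: "dfn (\<lambda>\<rho>. part (\<rho> i) (\<rho> j) (\<rho> k))" for i j k
    unfolding part_def least_level_def by (intro dfn_logic dfn_sub dfn_level dfn_meets)
  have "\<exists>G\<in>M. \<forall>m\<in>V. \<forall>x\<in>V. mp G m x \<longleftrightarrow> (\<exists>b\<in>V. mp F b x \<and> E x b \<and> part b m c)"
    by (rule class_of_pairs[OF _ c F(1)]) (intro dfn_logic dfn_mp dfn_part)
  then obtain G where G: "G \<in> M"
    and mp_G: "\<And>m x. m \<in> V \<Longrightarrow> x \<in> V \<Longrightarrow> mp G m x \<longleftrightarrow> (\<exists>b\<in>V. mp F b x \<and> E x b \<and> part b m c)"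
    by blast
  show ?thesis
  proof (rule that[OF G])
    fix m x y
    assume V: "m \<in> V" "x \<in> V" "y \<in> V" and "mp G m x" "mp G m y"
    then obtain b b' s s' where b: "b \<in> V" "mp F b x" "E x b" "b' \<in> V" "mp F b' y" "E y b'"
      and s: "s \<in> V" "least_level (meets m c) s" "s' \<in> V" "least_level (meets m c) s'"
      and b_s: "\<forall>y\<in>V. E y b \<longleftrightarrow> E y c \<and> \<not> E y m \<and> sub y s"
        "\<forall>y\<in>V. E y b' \<longleftrightarrow> E y c \<and> \<not> E y m \<and> sub y s'"
      unfolding mp_G[OF V(1,2)] mp_G[OF V(1,3)] part_def by blast
    have "s = s'" using least_level_unique s by blast
    then have "\<forall>y\<in>V. E y b \<longleftrightarrow> E y b'" using b_s by simp
    then have "El b = El b'"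
      using El_in_V b(1,4) mem_El_iff by blast
    then have "b = b'" using El_inject_V b(1,4) by blast
    then show "x = y" using F_unique V b by blast
  next
    fix m x
    assume "m \<in> V" "x \<in> V" "mp G m x"
    then show "x \<in> El c - El m"
      using mp_G mem_El_iff unfolding part_def by blast
  next
    fix m
    assume m: "m \<in> V" and ne: "El c - El m \<noteq> {}"
    then obtain z where z: "z \<in> V" "E z c" "\<not> E z m"
      using El_subset_V[OF c] mem_El_iff by blast
    then obtain t where "t \<in> V" "level t" "meets m c t"
      using level_cover[of z] unfolding meets_def by blast
    moreover have "\<exists>d\<in>M. El d = {t \<in> V. level t \<and> meets m c t}"
      by (rule comprehension2[OF _ V_subset_M[OF m] c]) (intro dfn_logic dfn_level dfn_meets)
    ultimately obtain s where s: "s \<in> V" "least_level (meets m c) s"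
      using least_level_exists by blast
    have "\<exists>b\<in>M. El b = {y \<in> V. E y c \<and> \<not> E y m \<and> sub y s}"
      by (rule comprehension3[OF _ c V_subset_M[OF m] V_subset_M[OF s(1)]]) (intro dfn_logic dfn_sub)
    then obtain b where b: "b \<in> M" "El b = {y \<in> V. E y c \<and> \<not> E y m \<and> sub y s}" by blast
    obtain p where p: "p \<in> V" "El p = {w \<in> V. El w \<subseteq> El s}" using power_set_El[OF s(1)] by blast
    have bV: "b \<in> V"
      by (rule set_of_subclass[OF p(1) b(1)]) (auto simp: p(2) b(2) sub_iff)
    have "part b m c"
      unfolding part_def using s b(2) mem_El_iff by blast
    have "\<exists>y\<in>V. E y b"
      using s(2) b(2) mem_El_iff unfolding least_level_def meets_def by blast
    then obtain x where "x \<in> M" "E x b" "maps_to M E F b x"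
      using F_choice bV V_subset_M by blast
    then have "x \<in> V" "mp F b x"
      using maps_to_iff[OF F(1)] b(1) by blast+
    with \<open>E x b\<close> \<open>part b m c\<close> bV show "\<exists>x\<in>V. mp G m x"
      using mp_G[OF m] by blast
  qed
qed

section \<open>Splitting infinite classes\<close>

definition ins :: "'a \<Rightarrow> 'a \<Rightarrow> 'a \<Rightarrow> bool" where
  "ins b x a \<longleftrightarrow> (\<forall>w\<in>V. E w b \<longleftrightarrow> w = x \<or> E w a)"

text \<open>With \<open>G\<close> a choice from complements, \<open>x\<close> is f m and
  \<open>y\<close> is g m; \<open>y\<close> is chosen after \<open>x\<close> has been added, which
  makes them distinct.\<close>

definition step :: "'a \<Rightarrow> 'a \<Rightarrow> 'a \<Rightarrow> bool" where
  "step G m n \<longleftrightarrow>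
     (\<exists>x\<in>V. \<exists>k\<in>V. \<exists>y\<in>V. mp G m x \<and> ins k x m \<and> mp G k y \<and> ins n y k)"

text \<open>
  The elements of the tower are the sets obtained from the empty set by iterating the step relation
  internally. Restricting the closure condition to subsets of \<open>m\<close> ensures that there are enough
  sets \<open>T\<close> to test against, such as the power set of \<open>m\<close>.
\<close>

definition tower :: "'a \<Rightarrow> 'a \<Rightarrow> bool" where
  "tower G m \<longleftrightarrow> (\<forall>T\<in>V. (\<forall>z\<in>V. (\<forall>w\<in>V. \<not> E w z) \<longrightarrow> E z T) \<longrightarrow>
     (\<forall>k\<in>V. \<forall>l\<in>V. E k T \<and> step G k l \<and> sub l m \<longrightarrow> E l T) \<longrightarrow> E m T)"

definition below :: "'a \<Rightarrow> 'a \<Rightarrow> 'a \<Rightarrow> bool" where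
  "below G m n \<longleftrightarrow> (\<exists>m'\<in>V. step G m m' \<and> sub m' n)"

lemma dfn_ins: "dfn (\<lambda>\<rho>. ins (\<rho> i) (\<rho> j) (\<rho> k))"
  unfolding ins_def by (intro dfn_logic)

lemma dfn_step: "dfn (\<lambda>\<rho>. step (\<rho> i) (\<rho> j) (\<rho> k))"
  unfolding step_def by (intro dfn_logic dfn_mp dfn_ins)

lemma dfn_tower: "dfn (\<lambda>\<rho>. tower (\<rho> i) (\<rho> j))"
  unfolding tower_def by (intro dfn_logic dfn_sub dfn_step)

lemma dfn_below: "dfn (\<lambda>\<rho>. below (\<rho> i) (\<rho> j) (\<rho> k))"
  unfolding below_def by (intro dfn_logic dfn_sub dfn_step)

lemma ins_iff:
  assumes "b \<in> V" "x \<in> V" "a \<in> V"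
  shows "ins b x a \<longleftrightarrow> El b = insert x (El a)"
proof -
  have "insert x (El a) \<subseteq> V" using assms El_in_V by blast
  moreover have "w \<in> insert x (El a) \<longleftrightarrow> w = x \<or> E w a" if "w \<in> V" for w
    using mem_El_iff[OF that] by simp
  ultimately show ?thesis
    using El_eq_iff[OF assms(1)] by (simp add: ins_def)
qed

lemma El_empty_iff: "z \<in> V \<Longrightarrow> (\<forall>w\<in>V. \<not> E w z) \<longleftrightarrow> El z = {}"
  by (simp add: El_eq_iff)

lemma sub_refl: "sub a a"
  by (simp add: sub_def)

lemma sub_trans: "sub a b \<Longrightarrow> sub b c \<Longrightarrow> sub a c"
  by (simp add: sub_def)

lemma sub_antisym: "a \<in> V \<Longrightarrow> b \<in> V \<Longrightarrow> sub a b \<Longrightarrow> sub b a \<Longrightarrow> a = b"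
  by (simp add: sub_iff El_inject_V)

lemma step_sub: "m \<in> V \<Longrightarrow> n \<in> V \<Longrightarrow> step G m n \<Longrightarrow> sub m n"
  unfolding step_def ins_def sub_def by blast

lemma tower_empty: "z \<in> V \<Longrightarrow> El z = {} \<Longrightarrow> tower G z"
  using El_empty_iff unfolding tower_def by blast

text \<open>A test set closed up to \<open>l\<close> is closed up to the smaller set
  \<open>k\<close>, hence contains \<open>k\<close> and then \<open>l\<close>.\<close>

lemma tower_step:
  assumes "k \<in> V" "l \<in> V" "tower G k" "step G k l"
  shows "tower G l"
  unfolding tower_def
proof (intro ballI impI)
  fix T
  assume T: "T \<in> V" "\<forall>z\<in>V. (\<forall>w\<in>V. \<not> E w z) \<longrightarrow> E z T"
    and closed: "\<forall>i\<in>V. \<forall>j\<in>V. E i T \<and> step G i j \<and> sub j l \<longrightarrow> E j T"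
  have "\<forall>i\<in>V. \<forall>j\<in>V. E i T \<and> step G i j \<and> sub j k \<longrightarrow> E j T"
    using closed sub_trans[OF _ step_sub[OF assms(1,2,4)]] by blast
  then have "E k T"
    using assms(3) T unfolding tower_def by blast
  then show "E l T"
    using closed assms(1,2,4) sub_refl by blast
qed

text \<open>The test set consists of the tower sets included in \<open>m\<close> that satisfy
  \<open>P\<close>; separation from the power set of \<open>m\<close> makes it a set.\<close>

lemma tower_induct:
  assumes P: "\<exists>c\<in>M. El c = {x \<in> V. tower G x \<and> P x}"
    and empty: "\<And>z. z \<in> V \<Longrightarrow> El z = {} \<Longrightarrow> P z"
    and step: "\<And>k l. k \<in> V \<Longrightarrow> l \<in> V \<Longrightarrow> tower G k \<Longrightarrow> P k \<Longrightarrow> step G k l \<Longrightarrow> P l"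
    and m: "m \<in> V" "tower G m"
  shows "P m"
proof -
  obtain c where c: "c \<in> M" "El c = {x \<in> V. tower G x \<and> P x}" using P by blast
  obtain p where p: "p \<in> V" "El p = {w \<in> V. El w \<subseteq> El m}" using power_set_El[OF m(1)] by blast
  obtain T where T: "T \<in> V" "El T = El p \<inter> El c" using separation[OF p(1) c(1)] by blast
  have T_iff: "E x T \<longleftrightarrow> sub x m \<and> tower G x \<and> P x" if "x \<in> V" for x
    using that T(2) p(2) c(2) by (simp add: sub_iff flip: mem_El_iff)
  have "\<forall>z\<in>V. (\<forall>w\<in>V. \<not> E w z) \<longrightarrow> E z T"
    using empty tower_empty by (simp add: El_empty_iff T_iff sub_iff)
  moreover have "\<forall>k\<in>V. \<forall>l\<in>V. E k T \<and> step G k l \<and> sub l m \<longrightarrow> E l T"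
    using step tower_step T_iff by blast
  ultimately have "E m T"
    using m T(1) unfolding tower_def by blast
  then show ?thesis using T_iff m by blast
qed

section \<open>The tower of a choice from the complements of sets in a class\<close>

context
  fixes G c
  assumes G: "G \<in> M"
    and G_unique: "\<And>m x y. m \<in> V \<Longrightarrow> x \<in> V \<Longrightarrow> y \<in> V \<Longrightarrow> mp G m x \<Longrightarrow> mp G m y \<Longrightarrow> x = y"
    and G_in: "\<And>m x. m \<in> V \<Longrightarrow> x \<in> V \<Longrightarrow> mp G m x \<Longrightarrow> x \<in> El c - El m"
    and G_exists: "\<And>m. m \<in> V \<Longrightarrow> El c - El m \<noteq> {} \<Longrightarrow> \<exists>x\<in>V. mp G m x"
begin

lemma stepE:
  assumes "step G m n" "m \<in> V" "n \<in> V"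
  obtains x k y where "x \<in> V" "k \<in> V" "y \<in> V" "mp G m x" "El k = insert x (El m)" "mp G k y"
    "El n = insert y (El k)"
  using assms ins_iff unfolding step_def by metis

lemma step_unique:
  assumes "m \<in> V" "n \<in> V" "n' \<in> V" "step G m n" "step G m n'"
  shows "n = n'"
proof -
  obtain x k y where 1: "x \<in> V" "k \<in> V" "y \<in> V" "mp G m x" "El k = insert x (El m)" "mp G k y"
    "El n = insert y (El k)"
    using stepE[OF assms(4,1,2)] .
  obtain x' k' y' where 2: "x' \<in> V" "k' \<in> V" "y' \<in> V" "mp G m x'" "El k' = insert x' (El m)"
    "mp G k' y'" "El n' = insert y' (El k')"
    using stepE[OF assms(5,1,3)] .
  have "x = x'" using G_unique[OF assms(1)] 1 2 by blast
  then have "k = k'" using El_inject_V[of k k'] 1 2 by simp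
  then have "y = y'" using G_unique[of k] 1 2 by blast
  then show ?thesis using El_inject_V[of n n'] assms \<open>k = k'\<close> 1 2 by simp
qed

text \<open>First half of the comparability argument familiar from Zermelo's well-ordering proof:
  \<open>good\<close> says that successors of tower sets properly inside \<open>m\<close> stay
  inside \<open>m\<close>, so the tower cannot jump past \<open>m\<close>.\<close>

lemma tower_sub_or_below:
  assumes m: "m \<in> V"
    and good: "\<forall>n\<in>V. tower G n \<longrightarrow> sub n m \<longrightarrow> n = m \<or> below G n m"
    and n: "n \<in> V" "tower G n"
  shows "sub n m \<or> below G m n"
proof (rule tower_induct[where P = "\<lambda>n. sub n m \<or> below G m n", OF _ _ _ n])
  show "\<exists>c\<in>M. El c = {n \<in> V. tower G n \<and> (sub n m \<or> below G m n)}"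
    by (rule comprehension2[OF _ G V_subset_M[OF m]]) (intro dfn_logic dfn_tower dfn_sub dfn_below)
next
  fix z
  assume "z \<in> V" "El z = {}"
  then show "sub z m \<or> below G m z" by (simp add: sub_iff)
next
  fix k l
  assume kl: "k \<in> V" "l \<in> V" "tower G k" "step G k l" and IH: "sub k m \<or> below G m k"
  consider "k = m" | "below G k m" | "below G m k"
    using good IH kl by blast
  then show "sub l m \<or> below G m l"
  proof cases
    case 1
    then show ?thesis using kl sub_refl unfolding below_def by blast
  next
    case 2
    then show ?thesis using step_unique[OF kl(1)] kl unfolding below_def by blast
  next
    case 3
    then show ?thesis using sub_trans[OF _ step_sub[OF kl(1,2,4)]] unfolding below_def by blast
  qed
qed

text \<open>Second half: the property \<open>good\<close> holds throughout the tower. For a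
  successor \<open>l\<close> of \<open>k\<close>, a tower set in \<open>l\<close> lies in
  \<open>k\<close> or includes the unique successor of \<open>k\<close>, which is
  \<open>l\<close>.\<close>

lemma tower_sub_imp_below:
  assumes m: "m \<in> V" "tower G m"
  shows "\<forall>n\<in>V. tower G n \<longrightarrow> sub n m \<longrightarrow> n = m \<or> below G n m"
proof (rule tower_induct[where P = "\<lambda>m. \<forall>n\<in>V. tower G n \<longrightarrow> sub n m \<longrightarrow> n = m \<or> below G n m",
      OF _ _ _ m])
  show "\<exists>c\<in>M. El c = {m \<in> V. tower G m \<and>
      (\<forall>n\<in>V. tower G n \<longrightarrow> sub n m \<longrightarrow> n = m \<or> below G n m)}"
    by (rule comprehension1[OF _ G]) (intro dfn_logic dfn_tower dfn_sub dfn_below)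
next
  fix z
  assume "z \<in> V" "El z = {}"
  then show "\<forall>n\<in>V. tower G n \<longrightarrow> sub n z \<longrightarrow> n = z \<or> below G n z"
    by (metis El_inject_V subset_empty sub_iff)
next
  fix k l
  assume kl: "k \<in> V" "l \<in> V" "tower G k" "step G k l"
    and IH: "\<forall>n\<in>V. tower G n \<longrightarrow> sub n k \<longrightarrow> n = k \<or> below G n k"
  show "\<forall>n\<in>V. tower G n \<longrightarrow> sub n l \<longrightarrow> n = l \<or> below G n l"
  proof (intro ballI impI)
    fix n
    assume n: "n \<in> V" "tower G n" "sub n l"
    consider "n = k" | "below G n k" | l' where "l' \<in> V" "step G k l'" "sub l' n"
      using tower_sub_or_below[OF kl(1) IH n(1,2)] IH n unfolding below_def by blast
    then show "n = l \<or> below G n l"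
    proof cases
      case 1
      then show ?thesis using kl sub_refl unfolding below_def by blast
    next
      case 2
      then show ?thesis using sub_trans[OF _ step_sub[OF kl(1,2,4)]] unfolding below_def by blast
    next
      case 3
      then have "l' = l" using step_unique[OF kl(1)] kl by blast
      then show ?thesis using 3 n kl sub_antisym by blast
    qed
  qed
qed

lemma tower_linear:
  assumes "m \<in> V" "tower G m" "n \<in> V" "tower G n"
  shows "m = n \<or> below G m n \<or> below G n m"
  using tower_sub_or_below[OF assms(1) tower_sub_imp_below[OF assms(1,2)] assms(3,4)]
    tower_sub_imp_below[OF assms(1,2)] assms by blast

lemma below_subset:
  assumes "m \<in> V" "n \<in> V" "step G m n" "below G m p"
  shows "El n \<subseteq> El p"
proof -
  obtain n' where n': "n' \<in> V" "step G m n'" "sub n' p"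
    using assms(4) unfolding below_def by blast
  then have "n' = n" using step_unique assms by blast
  then show ?thesis using n' sub_iff by blast
qed

text \<open>\<open>d\<close> consists of the first elements of the steps in the tower. The second
  elements stay outside it, and any finite number of steps can be carried out because
  \<open>c\<close> is infinite.\<close>

lemma split_class:
  assumes c: "c \<in> M" "infinite (El c)"
  shows "\<exists>d\<in>M. El d \<subseteq> El c \<and> infinite (El d) \<and> infinite (El c - El d)"
proof -
  have "\<exists>d\<in>M. El d = {x \<in> V. \<exists>m\<in>V. tower G m \<and> mp G m x \<and> (\<exists>n\<in>V. step G m n)}"
    by (rule comprehension1[OF _ G]) (intro dfn_logic dfn_tower dfn_mp dfn_step)
  then obtain d where d: "d \<in> M"
    "El d = {x \<in> V. \<exists>m\<in>V. tower G m \<and> mp G m x \<and> (\<exists>n\<in>V. step G m n)}" by blast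
  \<comment> \<open>Suppose \<open>y\<close> were also the first element of a step from
    \<open>m'\<close> to \<open>n'\<close>. If \<open>m = m'\<close>, then \<open>y = x\<close>,
    which is in \<open>k\<close>; if \<open>m\<close> is below \<open>m'\<close>, then
    \<open>y\<close> is in \<open>m'\<close>; if \<open>m'\<close> is below \<open>m\<close>, then
    \<open>y\<close> is in \<open>m\<close> and so in \<open>k\<close>. All three are
    excluded.\<close>
  have second: "y \<notin> El d"
    if m: "m \<in> V" "tower G m" and x: "x \<in> V" "mp G m x" and k: "k \<in> V" "El k = insert x (El m)"
      and y: "y \<in> V" "mp G k y" and n: "n \<in> V" "El n = insert y (El k)" for m x k y n
  proof
    assume "y \<in> El d"
    then obtain m' n' where m': "m' \<in> V" "tower G m'" "mp G m' y" and n': "n' \<in> V" "step G m' n'"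
      using d(2) by blast
    have step: "step G m n"
      unfolding step_def using m x k y n ins_iff by blast
    have y_n': "y \<in> El n'"
    proof -
      obtain x' where "x' \<in> V" "mp G m' x'" "x' \<in> El n'"
        using stepE[OF n'(2) m'(1) n'(1)] by (metis insertI1 insertI2)
      then show ?thesis using G_unique[OF m'(1)] y(1) m'(3) by blast
    qed
    have y_k: "y \<notin> El k" and y_m': "y \<notin> El m'"
      using G_in k(1) y m'(1,3) by blast+
    consider "m = m'" | "below G m m'" | "below G m' m"
      using tower_linear m m'(1,2) by blast
    then show False
    proof cases
      case 1
      then have "x = y" using G_unique[OF m(1)] x y(1) m'(3) by blast
      then show ?thesis using y_k k(2) by blast
    next
      case 2
      then show ?thesis using below_subset[OF m(1) n(1) step 2] n(2) y_m' by blast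
    next
      case 3
      then show ?thesis using below_subset[OF m'(1) n' 3] y_n' y_k k(2) by blast
    qed
  qed
  \<comment> \<open>The induction on \<open>N\<close> runs outside the model: only finitely many
    steps are taken, so \<open>El m\<close> stays externally finite and \<open>c\<close> still
    offers new elements.\<close>
  have approx: "\<exists>m\<in>V. tower G m \<and> finite (El m) \<and> El m \<subseteq> El c \<and>
      N \<le> card (El m \<inter> El d) \<and> N \<le> card (El m - El d)" for N
  proof (induction N)
    case 0
    obtain z where "z \<in> V" "El z = {}" using empty_El by blast
    then show ?case using tower_empty by (intro bexI[of _ z]) auto
  next
    case (Suc N)
    then obtain m where m: "m \<in> V" "tower G m" "finite (El m)" "El m \<subseteq> El c"
      "N \<le> card (El m \<inter> El d)" "N \<le> card (El m - El d)" by blast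
    have pick: "\<exists>x\<in>V. mp G k x \<and> x \<in> El c \<and> x \<notin> El k" if k: "k \<in> V" "finite (El k)" for k
    proof -
      have "El c - El k \<noteq> {}"
        using infinite_imp_nonempty[OF Diff_infinite_finite[OF k(2) c(2)]] .
      then show ?thesis using G_exists[OF k(1)] G_in[OF k(1)] by blast
    qed
    obtain x where x: "x \<in> V" "mp G m x" "x \<in> El c" "x \<notin> El m" using pick m(1,3) by blast
    obtain k where k: "k \<in> V" "El k = insert x (El m)" using insert_El[OF x(1) m(1)] by blast
    obtain y where y: "y \<in> V" "mp G k y" "y \<in> El c" "y \<notin> El k"
      using pick[OF k(1)] k(2) m(3) by (metis finite_insert)
    obtain n where n: "n \<in> V" "El n = insert y (El k)" using insert_El[OF y(1) k(1)] by blast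
    have step: "step G m n"
      unfolding step_def using m(1) x k y n ins_iff by blast
    have "x \<in> El d" using d(2) x m(1,2) n(1) step by blast
    moreover have "y \<notin> El d" using second[OF m(1,2) x(1,2) k y(1,2) n] .
    ultimately have "El n \<inter> El d = insert x (El m \<inter> El d)" "El n - El d = insert y (El m - El d)"
      unfolding n(2) k(2) by blast+
    then have "Suc N \<le> card (El n \<inter> El d)" "Suc N \<le> card (El n - El d)"
      using m(3,5,6) x(4) y(4) k(2) by simp_all
    moreover have "tower G n" using tower_step[OF m(1) n(1) m(2) step] .
    moreover have "finite (El n)" "El n \<subseteq> El c" using n(2) k(2) m(3,4) x(3) y(3) by simp_all
    ultimately show ?case using n(1) by blast
  qed
  have unbounded: "infinite A" if "\<And>N. \<exists>B. B \<subseteq> A \<and> N \<le> card B" for A :: "'a set"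
  proof
    assume "finite A"
    then show False
      using that[of "Suc (card A)"] card_mono[of A] by (metis not_less_eq_eq)
  qed
  have "infinite (El d)"
    by (rule unbounded) (meson approx Int_lower2)
  moreover have "infinite (El c - El d)"
    by (rule unbounded) (meson approx Diff_mono order_refl)
  moreover have "El d \<subseteq> El c"
    using d(2) G_in by blast
  ultimately show ?thesis using d(1) by blast
qed

end

lemma infinite_class_splits:
  assumes "c \<in> M" "infinite (El c)"
  shows "\<exists>d\<in>M. El d \<subseteq> El c \<and> infinite (El d) \<and> infinite (El c - El d)"
proof -
  obtain G where G: "G \<in> M"
    "\<And>m x y. m \<in> V \<Longrightarrow> x \<in> V \<Longrightarrow> y \<in> V \<Longrightarrow> mp G m x \<Longrightarrow> mp G m y \<Longrightarrow> x = y"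
    "\<And>m x. m \<in> V \<Longrightarrow> x \<in> V \<Longrightarrow> mp G m x \<Longrightarrow> x \<in> El c - El m"
    "\<And>m. m \<in> V \<Longrightarrow> El c - El m \<noteq> {} \<Longrightarrow> \<exists>x\<in>V. mp G m x"
    using choice_from_class_complements[OF assms(1)] by blast
  show ?thesis
    by (rule split_class[of G c, OF G assms])
qed

section \<open>The inclusion structure\<close>

lemma El_Int: "a \<in> M \<Longrightarrow> b \<in> M \<Longrightarrow> \<exists>c\<in>M. El c = El a \<inter> El b"
  using El_Diff by (metis Diff_Diff_Int)

lemma El_Un:
  assumes "a \<in> M" "b \<in> M"
  shows "\<exists>c\<in>M. El c = El a \<union> El b"
proof -
  obtain u where u: "u \<in> M" "El u = V" using El_V by blast
  obtain c where c: "c \<in> M" "El c = El u - El a" using El_Diff[OF u(1) assms(1)] by blast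
  obtain d where d: "d \<in> M" "El d = El c - El b" using El_Diff[OF c(1) assms(2)] by blast
  have "El u - El d = El a \<union> El b"
    unfolding d(2) c(2) u(2) using assms[THEN El_subset_V] by blast
  then show ?thesis using El_Diff[OF u(1) d(1)] by simp
qed

abbreviation (input) L :: "'a gorder" where
  "L \<equiv> order_structure M (incl M E)"

lemma carrier_L: "carrier L = M"
  by (simp add: order_structure_def)

lemma le_L: "a \<sqsubseteq>\<^bsub>L\<^esub> b \<longleftrightarrow> El a \<subseteq> El b"
  by (simp add: order_structure_def incl_iff)

lemma partial_order_L: "partial_order L"
proof
  show "(.=\<^bsub>L\<^esub>) = (=)" by (simp add: order_structure_def)
qed (auto simp: order_structure_def incl_iff El_inject[symmetric])

lemma bounded_lattice_L: "bounded_lattice L"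
proof -
  interpret partial_order L by (rule partial_order_L)
  show ?thesis
  proof
    fix a b
    assume "a \<in> carrier L" "b \<in> carrier L"
    then have ab: "a \<in> M" "b \<in> M" by (simp_all add: carrier_L)
    obtain c where "c \<in> M" "El c = El a \<union> El b" using El_Un[OF ab] by blast
    then have "least L c (Upper L {a, b})"
      using ab by (auto simp: least_def Upper_def carrier_L le_L)
    then show "\<exists>c. least L c (Upper L {a, b})" ..
    obtain d where "d \<in> M" "El d = El a \<inter> El b" using El_Int[OF ab] by blast
    then have "greatest L d (Lower L {a, b})"
      using ab by (auto simp: greatest_def Lower_def carrier_L le_L)
    then show "\<exists>d. greatest L d (Lower L {a, b})" ..
  next
    obtain z where "z \<in> V" "El z = {}" using empty_El by blast
    then have "least L z (carrier L)"
      using V_subset_M by (auto simp: least_def carrier_L le_L)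
    then show "\<exists>z. least L z (carrier L)" ..
    obtain u where "u \<in> M" "El u = V" using El_V by blast
    then have "greatest L u (carrier L)"
      using El_subset_V by (auto simp: greatest_def carrier_L le_L)
    then show "\<exists>u. greatest L u (carrier L)" ..
  qed
qed

lemma atomic_boolean_lattice_L: "atomic_boolean_lattice L"
proof -
  interpret bounded_lattice L by (rule bounded_lattice_L)
  \<comment> \<open>Meet and join are given through the order alone; comparison with the class
    intersection and union identifies their elements.\<close>
  have meet: "a \<sqinter>\<^bsub>L\<^esub> b \<in> M \<and> El (a \<sqinter>\<^bsub>L\<^esub> b) = El a \<inter> El b" if ab: "a \<in> M" "b \<in> M" for a b
  proof -
    obtain c where c: "c \<in> M" "El c = El a \<inter> El b" using El_Int[OF ab] by blast
    then have "c \<sqsubseteq>\<^bsub>L\<^esub> a \<sqinter>\<^bsub>L\<^esub> b"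
      using ab by (intro meet_le) (simp_all add: carrier_L le_L)
    then show ?thesis
      using ab c meet_left[of a b] meet_right[of a b] meet_closed[of a b]
      by (auto simp: carrier_L le_L)
  qed
  have join: "a \<squnion>\<^bsub>L\<^esub> b \<in> M \<and> El (a \<squnion>\<^bsub>L\<^esub> b) = El a \<union> El b" if ab: "a \<in> M" "b \<in> M" for a b
  proof -
    obtain c where c: "c \<in> M" "El c = El a \<union> El b" using El_Un[OF ab] by blast
    then have "a \<squnion>\<^bsub>L\<^esub> b \<sqsubseteq>\<^bsub>L\<^esub> c"
      using ab by (intro join_le) (simp_all add: carrier_L le_L)
    then show ?thesis
      using ab c join_left[of a b] join_right[of a b] join_closed[of a b]
      by (auto simp: carrier_L le_L)
  qed
  have bot: "\<bottom>\<^bsub>L\<^esub> \<in> M" "El \<bottom>\<^bsub>L\<^esub> = {}"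
  proof -
    obtain z where "z \<in> V" "El z = {}" using empty_El by blast
    then show "El \<bottom>\<^bsub>L\<^esub> = {}"
      using bottom_lower[of z] V_subset_M by (simp add: carrier_L le_L)
    show "\<bottom>\<^bsub>L\<^esub> \<in> M" using bottom_closed by (simp add: carrier_L)
  qed
  have top: "\<top>\<^bsub>L\<^esub> \<in> M" "El \<top>\<^bsub>L\<^esub> = V"
  proof -
    show 1: "\<top>\<^bsub>L\<^esub> \<in> M" using top_closed by (simp add: carrier_L)
    obtain u where "u \<in> M" "El u = V" using El_V by blast
    then show "El \<top>\<^bsub>L\<^esub> = V"
      using top_higher[of u] El_subset_V[OF 1] by (auto simp: carrier_L le_L)
  qed
  show ?thesis
  proof
    fix a b c
    assume "a \<in> carrier L" "b \<in> carrier L" "c \<in> carrier L"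
    then have abc: "a \<in> M" "b \<in> M" "c \<in> M" by (simp_all add: carrier_L)
    show "a \<sqinter>\<^bsub>L\<^esub> (b \<squnion>\<^bsub>L\<^esub> c) = (a \<sqinter>\<^bsub>L\<^esub> b) \<squnion>\<^bsub>L\<^esub> (a \<sqinter>\<^bsub>L\<^esub> c)"
      using abc by (intro El_inject[THEN iffD1]) (auto simp: meet join)
  next
    fix a
    assume "a \<in> carrier L"
    then have a: "a \<in> M" by (simp add: carrier_L)
    obtain b where b: "b \<in> M" "El b = V - El a"
      using El_Diff[OF top(1) a] top(2) by auto
    have "a \<sqinter>\<^bsub>L\<^esub> b = \<bottom>\<^bsub>L\<^esub>"
      using a b(1) by (intro El_inject[THEN iffD1]) (auto simp: meet bot b(2))
    moreover have "a \<squnion>\<^bsub>L\<^esub> b = \<top>\<^bsub>L\<^esub>"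
      using a b(1) El_subset_V[OF a] by (intro El_inject[THEN iffD1]) (auto simp: join top b(2))
    ultimately have "a \<sqinter>\<^bsub>L\<^esub> b = \<bottom>\<^bsub>L\<^esub> \<and> a \<squnion>\<^bsub>L\<^esub> b = \<top>\<^bsub>L\<^esub>" ..
    with b(1) show "\<exists>b\<in>carrier L. a \<sqinter>\<^bsub>L\<^esub> b = \<bottom>\<^bsub>L\<^esub> \<and> a \<squnion>\<^bsub>L\<^esub> b = \<top>\<^bsub>L\<^esub>"
      by (auto simp: carrier_L)
  next
    fix a
    assume "a \<in> carrier L" "a \<noteq> \<bottom>\<^bsub>L\<^esub>"
    then have "a \<in> M" "El a \<noteq> {}"
      using El_inject bot by (auto simp: carrier_L)
    then obtain x where x: "x \<in> V" "x \<in> El a" using El_subset_V by blast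
    obtain s where s: "s \<in> V" "El s = {x}" using pairing_El[OF x(1) x(1)] by auto
    have sM: "s \<in> M" using V_subset_M[OF s(1)] .
    have "b = s" if "b \<in> M" "b \<noteq> \<bottom>\<^bsub>L\<^esub>" "El b \<subseteq> El s" for b
    proof -
      have "El b \<noteq> {}" using that El_inject bot by blast
      then have "El b = El s" using that(3) unfolding s(2) by blast
      then show ?thesis using El_inject that(1) sM by blast
    qed
    then have "atom_of L s"
      using sM s(2) bot(2) by (auto simp: atom_of_def carrier_L le_L)
    then show "\<exists>s. atom_of L s \<and> s \<sqsubseteq>\<^bsub>L\<^esub> a"
      using x(2) s(2) by (auto simp: le_L)
  qed
qed

text \<open>If there were only finitely many sets, the injection sending \<open>x\<close> to its
  singleton would be onto, but the empty set is no singleton.\<close>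

lemma infinite_M: "infinite M"
proof
  assume "finite M"
  then have "finite V" by (simp add: sets_of_def)
  have "\<forall>x\<in>V. \<exists>s. s \<in> V \<and> El s = {x}" using pairing_El by fastforce
  then obtain f where f: "\<And>x. x \<in> V \<Longrightarrow> f x \<in> V" "\<And>x. x \<in> V \<Longrightarrow> El (f x) = {x}"
    by metis
  have "inj_on f V" by (rule inj_onI) (metis f(2) singleton_inject)
  then have "f ` V = V"
    using \<open>finite V\<close> f(1) by (intro endo_inj_surj) auto
  moreover obtain z where "z \<in> V" "El z = {}" using empty_El by blast
  ultimately show False using f(2) by (metis imageE insert_not_empty)
qed

lemma splitting_field_El: "splitting_field V (El ` M)"
proof
  show "X \<subseteq> V" if "X \<in> El ` M" for X using that El_subset_V by blast
  show "V \<in> El ` M" using El_V by (metis imageI)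
  show "X - Y \<in> El ` M" if "X \<in> El ` M" "Y \<in> El ` M" for X Y
  proof -
    obtain a b where "a \<in> M" "b \<in> M" "X = El a" "Y = El b" using \<open>X \<in> El ` M\<close> \<open>Y \<in> El ` M\<close> by blast
    then show ?thesis using El_Diff[of a b] by (metis imageI)
  qed
  show "{x} \<in> El ` M" if "x \<in> V" for x
    using pairing_El[OF that that] V_subset_M by (metis imageI insert_absorb2)
  show "\<exists>Y\<in>El ` M. Y \<subseteq> X \<and> infinite Y \<and> infinite (X - Y)" if "X \<in> El ` M" "infinite X" for X
  proof -
    obtain c where c: "c \<in> M" "X = El c" using \<open>X \<in> El ` M\<close> by blast
    then show ?thesis using infinite_class_splits[OF c(1)] \<open>infinite X\<close> by (metis imageI)
  qed
qed

lemma omega_saturated_incl: "omega_saturated M (incl M E)"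
proof (rule omega_saturated_isomorphic)
  show "inj_on El M" by (rule inj_onI) (simp add: El_inject)
  show "omega_saturated (El ` M) (\<subseteq>)"
    by (rule splitting_field.omega_saturated[OF splitting_field_El])
qed (simp add: incl_iff)

end

theorem theorem17:
  fixes M :: "'a set" and E :: "'a \<Rightarrow> 'a \<Rightarrow> bool"
  assumes "gbc_model M E"
  shows "atomic_boolean_lattice (order_structure M (incl M E)) \<and>
         infinite M \<and>
         omega_saturated M (incl M E)"
  using gbc_model.atomic_boolean_lattice_L[OF assms] gbc_model.infinite_M[OF assms]
    gbc_model.omega_saturated_incl[OF assms] by blast

end
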